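(* Let $G$ be a connected, locally finite, simple undirected graph with girth $4$ which is Ricci-flat (in the sense of Lin–Lu–Yau), and suppose that no vertex of $G$ lies on two distinct $4$-cycles. Then $G$ is isomorphic to one of the following two graphs. $R_1$: it has $14$ vertices $a,b,c,d,z_1,z_2$ and $w_{u,i}$ for $u\in\{a,b,c,d\}$, $i\in\{1,2\}$; its edges are $ab,bc,cd,da$ together with $u\,w_{u,i}$ and $w_{u,i}\,z_i$ for every $u\in\{a,b,c,d\}$ and $i\in\{1,2\}$. (So $abcd$ is a $4$-cycle, and each cycle vertex is joined to each of $z_1,z_2$ by a path of length $2$ through its own new middle vertex.) $R_2$: it has $12$ vertices $n_0,\dots,n_{11}$ and edges $n_0n_1,\ n_1n_2,\ n_2n_3,\ n_3n_0$ (a $4$-cycle), $n_4n_5,\ n_5n_7,\ n_7n_6,\ n_6n_4$ (a second $4$-cycle), $n_3n_4,\ n_1n_7$, and $n_0n_8,\ n_8n_6,\ n_0n_9,\ n_9n_5,\ n_2n_{10},\ n_{10}n_6,\ n_2n_{11},\ n_{11}n_5$.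
   Context: For a graph $G=(V,E)$, $N(x)$ is the neighbor set of $x$, $d_x=|N(x)|$ its degree, and $d(u,v)$ the graph distance. For $\alpha\in[0,1]$ and $x\in V$, let $m_x^\alpha$ be the probability distribution with $m_x^\alpha(x)=\alpha$, $m_x^\alpha(v)=(1-\alpha)/d_x$ for $v\in N(x)$, and $0$ otherwise. $W(m_x^\alpha,m_y^\alpha)$ is the transportation (Wasserstein-1) distance: the minimum of $\sum_{u,v}d(u,v)X_{uv}$ over all $X_{uv}\ge 0$ with $\sum_v X_{uv}=m_x^\alpha(u)$ and $\sum_u X_{uv}=m_y^\alpha(v)$. The Lin–Lu–Yau Ricci curvature of an edge $xy$ is $\kappa(x,y)=\lim_{\alpha\to1}\frac{1-W(m_x^\alpha,m_y^\alpha)}{1-\alpha}$. A graph is Ricci-flat if $\kappa(x,y)=0$ for every edge $xy$. The girth is the length of a shortest cycle. *)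

theory Defs
  imports "HOL-Analysis.Infinite_Sum" "HOL-Library.Extended_Nat"
begin

text \<open>A graph is a vertex set \<open>V\<close>, possibly infinite, together with a set \<open>E\<close> of
  two-element subsets of \<open>V\<close>.\<close>

definition simple_graph :: "'a set \<Rightarrow> 'a set set \<Rightarrow> bool" where
  "simple_graph V E \<longleftrightarrow> (\<forall>e\<in>E. \<exists>u\<in>V. \<exists>v\<in>V. u \<noteq> v \<and> e = {u, v})"

definition nbrs :: "'a set set \<Rightarrow> 'a \<Rightarrow> 'a set" where
  "nbrs E x = {v. {x, v} \<in> E}"

definition locally_finite_graph :: "'a set \<Rightarrow> 'a set set \<Rightarrow> bool" where
  "locally_finite_graph V E \<longleftrightarrow> (\<forall>x\<in>V. finite (nbrs E x))"

definition walk_betw :: "'a set \<Rightarrow> 'a set set \<Rightarrow> 'a \<Rightarrow> 'a list \<Rightarrow> 'a \<Rightarrow> bool" where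
  "walk_betw V E u p v \<longleftrightarrow>
     p \<noteq> [] \<and> set p \<subseteq> V \<and> hd p = u \<and> last p = v \<and> successively (\<lambda>x y. {x, y} \<in> E) p"

definition connected_graph :: "'a set \<Rightarrow> 'a set set \<Rightarrow> bool" where
  "connected_graph V E \<longleftrightarrow> V \<noteq> {} \<and> (\<forall>u\<in>V. \<forall>v\<in>V. \<exists>p. walk_betw V E u p v)"

text \<open>The length of a walk is its number of edges, one less than its number of vertices. The
  value of \<open>gdist\<close> is meaningful only for vertices in the same component.\<close>

definition gdist :: "'a set \<Rightarrow> 'a set set \<Rightarrow> 'a \<Rightarrow> 'a \<Rightarrow> nat" where
  "gdist V E u v = (LEAST n. \<exists>p. walk_betw V E u p v \<and> length p = Suc n)"

text \<open>A cycle is given by listing its vertices in cyclic order. Different lists may describe the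
  same cycle (rotations and reversals); as a subgraph the cycle is determined by its edge set.\<close>

definition is_cycle :: "'a set set \<Rightarrow> 'a list \<Rightarrow> bool" where
  "is_cycle E c \<longleftrightarrow> length c \<ge> 3 \<and> distinct c \<and>
     (\<forall>i<length c. {c ! i, c ! (Suc i mod length c)} \<in> E)"

definition cycle_edges :: "'a list \<Rightarrow> 'a set set" where
  "cycle_edges c = {{c ! i, c ! (Suc i mod length c)} | i. i < length c}"

text \<open>The girth of an acyclic graph is \<open>\<infinity>\<close>, the infimum of the empty set.\<close>

definition girth :: "'a set set \<Rightarrow> enat" where
  "girth E = (INF c\<in>{c. is_cycle E c}. enat (length c))"

definition no_vertex_on_two_4cycles :: "'a set \<Rightarrow> 'a set set \<Rightarrow> bool" where
  "no_vertex_on_two_4cycles V E \<longleftrightarrow>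
     \<not> (\<exists>x\<in>V. \<exists>c c'. is_cycle E c \<and> length c = 4 \<and> x \<in> set c \<and>
                     is_cycle E c' \<and> length c' = 4 \<and> x \<in> set c' \<and>
                     cycle_edges c \<noteq> cycle_edges c')"

definition walk_measure :: "'a set set \<Rightarrow> real \<Rightarrow> 'a \<Rightarrow> 'a \<Rightarrow> real" where
  "walk_measure E \<alpha> x v =
     (if v = x then \<alpha> else if v \<in> nbrs E x then (1 - \<alpha>) / real (card (nbrs E x)) else 0)"

definition couplings :: "'a set \<Rightarrow> ('a \<Rightarrow> real) \<Rightarrow> ('a \<Rightarrow> real) \<Rightarrow> ('a \<Rightarrow> 'a \<Rightarrow> real) set" where
  "couplings V \<mu> \<nu> = {X.
     (\<forall>u\<in>V. \<forall>v\<in>V. X u v \<ge> 0) \<and>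
     (\<forall>u\<in>V. ((\<lambda>v. X u v) has_sum \<mu> u) V) \<and>
     (\<forall>v\<in>V. ((\<lambda>u. X u v) has_sum \<nu> v) V)}"

text \<open>Sums over \<open>V\<close> are unordered sums because \<open>V\<close> may be infinite. For finitely supported
  distributions, such as those given by \<open>walk_measure\<close> in a locally finite graph, every coupling
  vanishes on \<open>V \<times> V\<close> outside a finite set, so the cost below is a finite sum, and the infimum is
  a minimum (of a linear function over a compact polytope).\<close>

definition wasserstein :: "'a set \<Rightarrow> 'a set set \<Rightarrow> ('a \<Rightarrow> real) \<Rightarrow> ('a \<Rightarrow> real) \<Rightarrow> real" where
  "wasserstein V E \<mu> \<nu> =
     (INF X\<in>couplings V \<mu> \<nu>. \<Sum>\<^sub>\<infinity>(u, v)\<in>V \<times> V. real (gdist V E u v) * X u v)"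

text \<open>\<open>has_LLY_curvature V E x y k\<close> means that the limit defining the Lin--Lu--Yau curvature
  \<open>\<kappa>(x, y)\<close> exists and equals \<open>k\<close>. It is a left limit since \<open>\<alpha>\<close> ranges over \<open>[0, 1]\<close>.\<close>

definition has_LLY_curvature :: "'a set \<Rightarrow> 'a set set \<Rightarrow> 'a \<Rightarrow> 'a \<Rightarrow> real \<Rightarrow> bool" where
  "has_LLY_curvature V E x y k \<longleftrightarrow>
     ((\<lambda>\<alpha>. (1 - wasserstein V E (walk_measure E \<alpha> x) (walk_measure E \<alpha> y)) / (1 - \<alpha>))
        \<longlongrightarrow> k) (at_left 1)"

definition ricci_flat :: "'a set \<Rightarrow> 'a set set \<Rightarrow> bool" where
  "ricci_flat V E \<longleftrightarrow> (\<forall>x y. {x, y} \<in> E \<longrightarrow> has_LLY_curvature V E x y 0)"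

definition graph_iso :: "'a set \<Rightarrow> 'a set set \<Rightarrow> 'b set \<Rightarrow> 'b set set \<Rightarrow> bool" where
  "graph_iso V E V' E' \<longleftrightarrow>
     (\<exists>f. bij_betw f V V' \<and> (\<forall>u\<in>V. \<forall>v\<in>V. {u, v} \<in> E \<longleftrightarrow> {f u, f v} \<in> E'))"

datatype corner = Ca | Cb | Cc | Cd

text \<open>\<open>Corner u\<close>, \<open>Mid u i\<close> and \<open>Hub i\<close> stand for the vertices \<open>u\<close>, \<open>w\<^sub>u\<^sub>,\<^sub>i\<close> and \<open>z\<^sub>i\<close>; the index
  \<open>i\<close> is restricted to \<open>{1, 2}\<close> in the vertex set below.\<close>

datatype R1_vertex = Corner corner | Mid corner nat | Hub nat

definition R1_verts :: "R1_vertex set" where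
  "R1_verts = {Corner u | u. True} \<union> {Mid u i | u i. i \<in> {1, 2}} \<union> {Hub i | i. i \<in> {1, 2}}"

definition R1_edges :: "R1_vertex set set" where
  "R1_edges =
     {{Corner Ca, Corner Cb}, {Corner Cb, Corner Cc}, {Corner Cc, Corner Cd}, {Corner Cd, Corner Ca}}
     \<union> {{Corner u, Mid u i} | u i. i \<in> {1, 2}}
     \<union> {{Mid u i, Hub i} | u i. i \<in> {1, 2}}"

definition R2_verts :: "nat set" where
  "R2_verts = {0..11}"

definition R2_edges :: "nat set set" where
  "R2_edges =
     {{0, 1}, {1, 2}, {2, 3}, {3, 0},
      {4, 5}, {5, 7}, {7, 6}, {6, 4},
      {3, 4}, {1, 7},
      {0, 8}, {8, 6}, {0, 9}, {9, 5}, {2, 10}, {10, 6}, {2, 11}, {11, 5}}"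

end

theory Submission
  imports Defs
begin

text \<open>For an edge \<open>xy\<close> of a triangle-free graph the transport problem reduces to moving the
  mass of \<open>N(x) - {y}\<close> into \<open>N(y) - {x}\<close>, where the distances are \<open>1\<close> (the edge lies on a
  4-cycle), \<open>2\<close> (on a 5-cycle) or \<open>3\<close>. Since \<open>\<kappa>(x, y) = 0\<close>, every potential and every
  transport plan yields an inequality, and a handful of them determines the edges: off the 4-cycles
  the end degrees are \<open>(2,2)\<close>, \<open>(2,3)\<close>, \<open>(2,4)\<close> or \<open>(3,3)\<close>, and each case
  prescribes which outer neighbours have a common neighbour; similarly for edges on a 4-cycle.

  Then the degrees around one 4-cycle are examined. They are \<open>3\<close> or \<open>4\<close>, and not all
  \<open>3\<close>. Two adjacent vertices of degree \<open>4\<close> force \<open>4,4,4,4\<close>, and the two outer neighbours of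
  each corner lead to two common hubs, which is \<open>R\<^sub>1\<close>. The pattern \<open>3,4,3,4\<close> gives \<open>R\<^sub>2\<close>, and
  \<open>3,4,3,3\<close> would force a second 4-cycle with pattern \<open>3,4,3,4\<close>.\<close>

section \<open>Transport of finitely supported distributions\<close>

text \<open>The two kinds of inequality pull in opposite directions. A potential bounds the
  curvature from above: it keeps degrees small and forces common neighbours to exist. A transport
  plan bounds it from below: it keeps degrees large and forbids common neighbours. With \<alpha> = 1
  - \<epsilon> both bounds are affine in \<epsilon>, so no limit survives in the combinatorial part;
  the constants there are potential values constrained by the distances 1, 2, 3, or masses that fill
  capacities 1/d.

  Uniqueness of the 4-cycle at a vertex does two jobs: across an edge of a 4-cycle exactly one outer
  pair is at distance 1, and every edge leaving a 4-cycle at a corner lies on none. The hardest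
  exclusion is a corner of degree 2. It is refuted not at one edge but by following outer neighbours
  of three corners to two adjacent vertices of degree 4, whose edge can be neither off nor on a
  4-cycle.\<close>

lemma coupling_support:
  assumes X: "X \<in> couplings V \<mu> \<nu>"
    and ST: "finite S" "S \<subseteq> V" "finite T" "T \<subseteq> V"
    and \<mu>: "\<And>u. u \<in> V - S \<Longrightarrow> \<mu> u = 0" and \<nu>: "\<And>v. v \<in> V - T \<Longrightarrow> \<nu> v = 0"
  shows "\<And>u v. u \<in> V \<Longrightarrow> v \<in> V \<Longrightarrow> u \<notin> S \<or> v \<notin> T \<Longrightarrow> X u v = 0"
    and "\<And>u. u \<in> V \<Longrightarrow> (\<Sum>v\<in>T. X u v) = \<mu> u"
    and "\<And>v. v \<in> V \<Longrightarrow> (\<Sum>u\<in>S. X u v) = \<nu> v"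
proof -
  have nn: "X u v \<ge> 0" if "u \<in> V" "v \<in> V" for u v
    using X that by (auto simp: couplings_def)
  have row: "((\<lambda>v. X u v) has_sum \<mu> u) V" if "u \<in> V" for u
    using X that by (auto simp: couplings_def)
  have col: "((\<lambda>u. X u v) has_sum \<nu> v) V" if "v \<in> V" for v
    using X that by (auto simp: couplings_def)
  show z: "X u v = 0" if "u \<in> V" "v \<in> V" "u \<notin> S \<or> v \<notin> T" for u v
    using that(3)
  proof
    assume "u \<notin> S"
    then show ?thesis
      using nonneg_has_sum_le_0D[OF row[OF that(1)]] \<mu>[of u] nn that by auto
  next
    assume "v \<notin> T"
    then show ?thesis
      using nonneg_has_sum_le_0D[OF col[OF that(2)]] \<nu>[of v] nn that by auto
  qed
  show "(\<Sum>v\<in>T. X u v) = \<mu> u" if "u \<in> V" for u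
  proof -
    have "((\<lambda>v. X u v) has_sum (\<Sum>v\<in>T. X u v)) V"
      by (rule has_sum_finite_neutralI[of T]) (use ST z that in auto)
    with row[OF that] show ?thesis using has_sum_unique by blast
  qed
  show "(\<Sum>u\<in>S. X u v) = \<nu> v" if "v \<in> V" for v
  proof -
    have "((\<lambda>u. X u v) has_sum (\<Sum>u\<in>S. X u v)) V"
      by (rule has_sum_finite_neutralI[of S]) (use ST z that in auto)
    with col[OF that] show ?thesis using has_sum_unique by blast
  qed
qed

lemma infsum_finite_support:
  fixes h :: "'a \<Rightarrow> 'a \<Rightarrow> real"
  assumes ST: "finite S" "S \<subseteq> V" "finite T" "T \<subseteq> V"
    and z: "\<And>u v. u \<in> V \<Longrightarrow> v \<in> V \<Longrightarrow> u \<notin> S \<or> v \<notin> T \<Longrightarrow> h u v = 0"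
  shows "(\<Sum>\<^sub>\<infinity>(u, v)\<in>V \<times> V. h u v) = (\<Sum>u\<in>S. \<Sum>v\<in>T. h u v)"
proof -
  have "((\<lambda>(u, v). h u v) has_sum (\<Sum>(u, v)\<in>S \<times> T. h u v)) (V \<times> V)"
    by (rule has_sum_finite_neutralI[of "S \<times> T"]) (use ST z in auto)
  then show ?thesis
    by (simp add: infsumI sum.cartesian_product)
qed

lemma wasserstein_le:
  assumes "X \<in> couplings V \<mu> \<nu>"
    and "finite S" "S \<subseteq> V" "finite T" "T \<subseteq> V"
    and "\<And>u v. u \<in> V \<Longrightarrow> v \<in> V \<Longrightarrow> u \<notin> S \<or> v \<notin> T \<Longrightarrow> X u v = 0"
  shows "wasserstein V E \<mu> \<nu> \<le> (\<Sum>u\<in>S. \<Sum>v\<in>T. real (gdist V E u v) * X u v)"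
proof -
  have "(\<Sum>\<^sub>\<infinity>(u, v)\<in>V \<times> V. real (gdist V E u v) * X u v) =
      (\<Sum>u\<in>S. \<Sum>v\<in>T. real (gdist V E u v) * X u v)"
    by (rule infsum_finite_support) (use assms in auto)
  \<comment> \<open>A real infimum is a lower bound only if the set is bounded below; here costs are
    nonnegative.\<close>
  moreover have bdd: "bdd_below ((\<lambda>X. \<Sum>\<^sub>\<infinity>(u, v)\<in>V \<times> V. real (gdist V E u v) * X u v) ` couplings V \<mu> \<nu>)"
    by (rule bdd_belowI2[of _ 0], rule infsum_nonneg) (auto simp: couplings_def)
  ultimately show ?thesis
    unfolding wasserstein_def using cINF_lower[OF bdd assms(1)] by simp
qed

text \<open>It serves to show that couplings exist: the real infimum of an empty set would carry no
  information.\<close>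

lemma product_coupling:
  assumes "\<And>u. u \<in> V \<Longrightarrow> \<mu> u \<ge> 0" "\<And>u. u \<in> V \<Longrightarrow> \<nu> u \<ge> 0"
    and "(\<mu> has_sum 1) V" "(\<nu> has_sum 1) V"
  shows "(\<lambda>u v. \<mu> u * \<nu> v) \<in> couplings V \<mu> \<nu>"
  using assms has_sum_cmult_right[OF assms(4)] has_sum_cmult_left[OF assms(3)]
  by (auto simp: couplings_def)

text \<open>Weak Kantorovich duality: integrating \<open>f u - f v\<close> against a coupling gives
  the left side, whatever the coupling, and the pointwise bound compares it with the cost. Values of
  \<open>f\<close> off \<open>S\<close> and \<open>T\<close> never enter.\<close>

lemma wasserstein_ge:
  assumes ne: "couplings V \<mu> \<nu> \<noteq> {}"
    and ST: "finite S" "S \<subseteq> V" "finite T" "T \<subseteq> V"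
    and supp: "\<And>u. u \<in> V - S \<Longrightarrow> \<mu> u = 0" "\<And>v. v \<in> V - T \<Longrightarrow> \<nu> v = 0"
    and f: "\<And>u v. u \<in> S \<Longrightarrow> v \<in> T \<Longrightarrow> f u - f v \<le> real (gdist V E u v)"
  shows "(\<Sum>u\<in>S. f u * \<mu> u) - (\<Sum>v\<in>T. f v * \<nu> v) \<le> wasserstein V E \<mu> \<nu>"
  unfolding wasserstein_def
proof (rule cINF_greatest[OF ne])
  fix X assume X: "X \<in> couplings V \<mu> \<nu>"
  note s = coupling_support[OF X ST supp]
  have "(\<Sum>u\<in>S. f u * \<mu> u) = (\<Sum>u\<in>S. \<Sum>v\<in>T. f u * X u v)"
    by (rule sum.cong) (use ST s(2) in \<open>auto simp: subset_iff simp flip: sum_distrib_left\<close>)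
  moreover have "(\<Sum>v\<in>T. f v * \<nu> v) = (\<Sum>v\<in>T. \<Sum>u\<in>S. f v * X u v)"
    by (rule sum.cong) (use ST s(3) in \<open>auto simp: subset_iff simp flip: sum_distrib_left\<close>)
  then have "(\<Sum>v\<in>T. f v * \<nu> v) = (\<Sum>u\<in>S. \<Sum>v\<in>T. f v * X u v)"
    by (simp add: sum.swap[of _ T])
  ultimately have "(\<Sum>u\<in>S. f u * \<mu> u) - (\<Sum>v\<in>T. f v * \<nu> v) = (\<Sum>u\<in>S. \<Sum>v\<in>T. (f u - f v) * X u v)"
    by (simp add: sum_subtractf left_diff_distrib)
  also have "\<dots> \<le> (\<Sum>u\<in>S. \<Sum>v\<in>T. real (gdist V E u v) * X u v)"
    using X ST f by (intro sum_mono mult_right_mono) (auto simp: couplings_def subset_iff)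
  also have "\<dots> = (\<Sum>\<^sub>\<infinity>(u, v)\<in>V \<times> V. real (gdist V E u v) * X u v)"
    by (rule infsum_finite_support[symmetric]) (use ST s(1) in auto)
  finally show "(\<Sum>u\<in>S. f u * \<mu> u) - (\<Sum>v\<in>T. f v * \<nu> v) \<le> \<dots>" .
qed

text \<open>With \<epsilon> = 1 - \<alpha> the hypothesis bounds the difference quotient by
  \<open>K\<close> on a whole left neighbourhood of 1, so the bound passes to the limit.\<close>

lemma LLY_curvature_le:
  assumes "has_LLY_curvature V E x y k"
    and "\<And>\<epsilon>. 0 < \<epsilon> \<Longrightarrow> \<epsilon> \<le> 1/2 \<Longrightarrow>
      1 - \<epsilon> * K \<le> wasserstein V E (walk_measure E (1 - \<epsilon>) x) (walk_measure E (1 - \<epsilon>) y)"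
  shows "k \<le> K"
proof (rule tendsto_upperbound[OF assms(1)[unfolded has_LLY_curvature_def]])
  have "(1 - wasserstein V E (walk_measure E \<alpha> x) (walk_measure E \<alpha> y)) / (1 - \<alpha>) \<le> K"
    if "1/2 < \<alpha>" "\<alpha> < 1" for \<alpha>
    using assms(2)[of "1 - \<alpha>"] that by (simp add: divide_le_eq mult.commute)
  then show "\<forall>\<^sub>F \<alpha> in at_left 1.
      (1 - wasserstein V E (walk_measure E \<alpha> x) (walk_measure E \<alpha> y)) / (1 - \<alpha>) \<le> K"
    by (intro eventually_at_leftI[of "1/2"]) auto
qed simp

lemma LLY_curvature_ge:
  assumes "has_LLY_curvature V E x y k"
    and "\<And>\<epsilon>. 0 < \<epsilon> \<Longrightarrow> \<epsilon> \<le> 1/2 \<Longrightarrow>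
      wasserstein V E (walk_measure E (1 - \<epsilon>) x) (walk_measure E (1 - \<epsilon>) y) \<le> 1 - \<epsilon> * K"
  shows "K \<le> k"
proof (rule tendsto_lowerbound[OF assms(1)[unfolded has_LLY_curvature_def]])
  have "K \<le> (1 - wasserstein V E (walk_measure E \<alpha> x) (walk_measure E \<alpha> y)) / (1 - \<alpha>)"
    if "1/2 < \<alpha>" "\<alpha> < 1" for \<alpha>
    using assms(2)[of "1 - \<alpha>"] that by (simp add: le_divide_eq mult.commute)
  then show "\<forall>\<^sub>F \<alpha> in at_left 1.
      K \<le> (1 - wasserstein V E (walk_measure E \<alpha> x) (walk_measure E \<alpha> y)) / (1 - \<alpha>)"
    by (intro eventually_at_leftI[of "1/2"]) auto
qed simp

section \<open>Distances up to three\<close>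

definition common_nbr :: "'a set set \<Rightarrow> 'a \<Rightarrow> 'a \<Rightarrow> bool" where
  "common_nbr E u v \<longleftrightarrow> nbrs E u \<inter> nbrs E v \<noteq> {}"

text \<open>Only the diagonals are required to be distinct; adjacent corners differ because there
  are no loops.\<close>

definition square :: "'a set set \<Rightarrow> 'a \<Rightarrow> 'a \<Rightarrow> 'a \<Rightarrow> 'a \<Rightarrow> bool" where
  "square E x y z t \<longleftrightarrow> y \<in> nbrs E x \<and> z \<in> nbrs E y \<and> t \<in> nbrs E z \<and> x \<in> nbrs E t \<and> x \<noteq> z \<and> y \<noteq> t"

text \<open>Agrees with the graph distance on pairs at distance at most \<open>3\<close>, and is \<open>3\<close> on all others.\<close>

definition dist3 :: "'a set set \<Rightarrow> 'a \<Rightarrow> 'a \<Rightarrow> real" where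
  "dist3 E u v = (if u = v then 0 else if v \<in> nbrs E u then 1 else if common_nbr E u v then 2 else 3)"

locale graph =
  fixes V :: "'a set" and E :: "'a set set"
  assumes simple: "simple_graph V E"
    and conn: "connected_graph V E"
    and locfin: "locally_finite_graph V E"
begin

abbreviation N :: "'a \<Rightarrow> 'a set" where "N \<equiv> nbrs E"
abbreviation dg :: "'a \<Rightarrow> nat" where "dg x \<equiv> card (N x)"

lemma N_sym: "v \<in> N u \<longleftrightarrow> u \<in> N v"
  by (simp add: nbrs_def insert_commute)

lemma N_V:
  assumes "v \<in> N u"
  shows "u \<in> V" "v \<in> V"
proof -
  have "{u, v} \<in> E" using assms by (simp add: nbrs_def)
  then obtain a b where "a \<in> V" "b \<in> V" "{u, v} = {a, b}"
    using simple unfolding simple_graph_def by meson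
  then show "u \<in> V" "v \<in> V" by (auto simp: doubleton_eq_iff)
qed

lemma N_irrefl: "v \<notin> N v"
proof
  assume "v \<in> N v"
  then have "{v, v} \<in> E" by (simp add: nbrs_def)
  then obtain a b where "a \<noteq> b" "{v, v} = {a, b}"
    using simple unfolding simple_graph_def by meson
  then show False by (auto simp: doubleton_eq_iff)
qed

lemma N_finite: "finite (N u)"
proof (cases "N u = {}")
  case False
  then have "u \<in> V" using N_V(1) by blast
  then show ?thesis using locfin by (simp add: locally_finite_graph_def)
qed simp

lemma common_nbr_iff: "common_nbr E u v \<longleftrightarrow> (\<exists>w. w \<in> N u \<and> w \<in> N v)"
  by (auto simp: common_nbr_def)

text \<open>\<open>gdist\<close> is a least length, so values up to 3 are settled by knowing which
  pairs are joined by walks on 1, 2, 3 or 4 vertices.\<close>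

lemma ex_walk_length_iff:
  "(\<exists>p. walk_betw V E u p v \<and> length p = Suc 0) \<longleftrightarrow> u = v \<and> u \<in> V" (is ?A)
  "(\<exists>p. walk_betw V E u p v \<and> length p = Suc 1) \<longleftrightarrow> v \<in> N u" (is ?B)
  "(\<exists>p. walk_betw V E u p v \<and> length p = Suc 2) \<longleftrightarrow> common_nbr E u v" (is ?C)
  "(\<exists>p. walk_betw V E u p v \<and> length p = Suc 3) \<longleftrightarrow> (\<exists>a b. a \<in> N u \<and> b \<in> N a \<and> v \<in> N b)" (is ?D)
proof -
  have len: "length p = Suc 0 \<longleftrightarrow> (\<exists>a. p = [a])" "length p = Suc 1 \<longleftrightarrow> (\<exists>a b. p = [a, b])"
    "length p = Suc 2 \<longleftrightarrow> (\<exists>a b c. p = [a, b, c])" "length p = Suc 3 \<longleftrightarrow> (\<exists>a b c d. p = [a, b, c, d])"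
    for p :: "'a list"
    by (auto simp: length_Suc_conv numeral_eq_Suc)
  have 1: "walk_betw V E u [a] v \<longleftrightarrow> u = a \<and> v = a \<and> a \<in> V" for a
    by (auto simp: walk_betw_def)
  have 2: "walk_betw V E u [a, b] v \<longleftrightarrow> u = a \<and> v = b \<and> b \<in> N a" for a b
    using N_V[of b a] by (auto simp: walk_betw_def nbrs_def)
  have 3: "walk_betw V E u [a, b, c] v \<longleftrightarrow> u = a \<and> v = c \<and> b \<in> N a \<and> c \<in> N b" for a b c
    using N_V[of b a] N_V[of c b] by (auto simp: walk_betw_def nbrs_def)
  have 4: "walk_betw V E u [a, b, c, d] v \<longleftrightarrow> u = a \<and> v = d \<and> b \<in> N a \<and> c \<in> N b \<and> d \<in> N c" for a b c d
    using N_V[of b a] N_V[of c b] N_V[of d c] by (auto simp: walk_betw_def nbrs_def)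
  show ?A unfolding len(1) using 1 by metis
  show ?B unfolding len(2) using 2 by metis
  show ?C unfolding len(3) common_nbr_iff using 3 N_sym by metis
  show ?D unfolding len(4) using 4 by metis
qed

lemma gdist_eq_dist3:
  assumes "u \<in> V" "u = v \<or> v \<in> N u \<or> common_nbr E u v \<or> (\<exists>a b. a \<in> N u \<and> b \<in> N a \<and> v \<in> N b)"
  shows "real (gdist V E u v) = dist3 E u v"
proof -
  have least: "gdist V E u v = n"
    if "\<exists>p. walk_betw V E u p v \<and> length p = Suc n"
      "\<And>m. m < n \<Longrightarrow> \<not> (\<exists>p. walk_betw V E u p v \<and> length p = Suc m)" for n
    unfolding gdist_def by (rule Least_equality) (use that not_le in blast)+
  consider "u = v" | "u \<noteq> v" "v \<in> N u" | "u \<noteq> v" "v \<notin> N u" "common_nbr E u v"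
    | "u \<noteq> v" "v \<notin> N u" "\<not> common_nbr E u v" by blast
  then show ?thesis
  proof cases
    case 1
    then show ?thesis using least[of 0] ex_walk_length_iff(1)[of u v] assms by (auto simp: dist3_def)
  next
    case 2
    have "gdist V E u v = 1"
      by (rule least) (use 2 ex_walk_length_iff[of u v] in \<open>auto simp: less_Suc_eq\<close>)
    with 2 show ?thesis by (simp add: dist3_def)
  next
    case 3
    have "gdist V E u v = 2"
      by (rule least) (use 3 ex_walk_length_iff[of u v] in \<open>auto simp: less_Suc_eq numeral_eq_Suc\<close>)
    with 3 show ?thesis by (simp add: dist3_def)
  next
    case 4
    have "gdist V E u v = 3"
      by (rule least) (use 4 assms ex_walk_length_iff[of u v] in \<open>auto simp: less_Suc_eq numeral_eq_Suc\<close>)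
    with 4 show ?thesis by (simp add: dist3_def)
  qed
qed

lemma walk_measure_sum:
  assumes "x \<in> V"
  shows "(\<Sum>u\<in>insert x (N x). f u * walk_measure E \<alpha> x u) =
    f x * \<alpha> + (1 - \<alpha>) * (\<Sum>u\<in>N x. f u) / real (dg x)"
proof -
  have "(\<Sum>u\<in>N x. f u * walk_measure E \<alpha> x u) = (\<Sum>u\<in>N x. f u * ((1 - \<alpha>) / real (dg x)))"
    by (rule sum.cong) (auto simp: walk_measure_def N_irrefl)
  also have "\<dots> = (1 - \<alpha>) * (\<Sum>u\<in>N x. f u) / real (dg x)"
    by (simp add: sum_distrib_left sum_divide_distrib mult_ac)
  moreover have "walk_measure E \<alpha> x x = \<alpha>" by (simp add: walk_measure_def)
  ultimately show ?thesis
    by (simp add: N_irrefl N_finite)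
qed

lemma walk_measure_has_sum:
  assumes "N x \<noteq> {}"
  shows "(walk_measure E \<alpha> x has_sum 1) V"
proof (rule has_sum_finite_neutralI[of "insert x (N x)"])
  show "insert x (N x) \<subseteq> V" using assms N_V by blast
  have "x \<in> V" using assms N_V by blast
  then show "1 = (\<Sum>u\<in>insert x (N x). walk_measure E \<alpha> x u)"
    using walk_measure_sum[of x "\<lambda>_. 1" \<alpha>] assms N_finite by simp
qed (auto simp: N_finite walk_measure_def)

end

section \<open>Inequalities from vanishing curvature\<close>

lemma length_eq_4_iff: "length c = 4 \<longleftrightarrow> (\<exists>x y z t. c = [x, y, z, t])"
  by (auto simp: numeral_eq_Suc length_Suc_conv)

lemma is_cycle4:
  "is_cycle E [x, y, z, t] \<longleftrightarrow>
    distinct [x, y, z, t] \<and> {x, y} \<in> E \<and> {y, z} \<in> E \<and> {z, t} \<in> E \<and> {t, x} \<in> E"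
  by (simp add: is_cycle_def All_less_Suc) blast

lemma is_cycle3:
  "is_cycle E [x, y, z] \<longleftrightarrow> distinct [x, y, z] \<and> {x, y} \<in> E \<and> {y, z} \<in> E \<and> {z, x} \<in> E"
  by (simp add: is_cycle_def All_less_Suc) blast

lemma square_cycle:
  assumes "square E x y z t" and "\<And>v. v \<notin> nbrs E v"
  shows "is_cycle E [x, y, z, t]"
  using assms by (auto simp: is_cycle4 square_def nbrs_def)

lemma cycle_square: "is_cycle E [x, y, z, t] \<Longrightarrow> square E x y z t"
  by (auto simp: is_cycle4 square_def nbrs_def)

lemma cycle_edges4: "cycle_edges [x, y, z, t] = {{x, y}, {y, z}, {z, t}, {t, x}}"
proof -
  have "{i. i < (4::nat)} = {0, 1, 2, 3}" by auto
  moreover have "cycle_edges [x, y, z, t] =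
      (\<lambda>i. {[x, y, z, t] ! i, [x, y, z, t] ! (Suc i mod 4)}) ` {i. i < (4::nat)}"
    by (auto simp: cycle_edges_def)
  ultimately show ?thesis by simp
qed

lemma girth_attained:
  assumes "girth E = enat n"
  obtains c where "is_cycle E c" "length c = n"
proof -
  have "{c. is_cycle E c} \<noteq> {}"
  proof
    assume "{c. is_cycle E c} = {}"
    then have "girth E = \<infinity>" unfolding girth_def by (simp only:) (simp add: top_enat_def)
    with assms show False by simp
  qed
  then obtain c where "is_cycle E c" by auto
  then have "enat (length c) \<in> (\<lambda>c. enat (length c)) ` {c. is_cycle E c}" by simp
  then have "girth E \<in> (\<lambda>c. enat (length c)) ` {c. is_cycle E c}"
    unfolding girth_def by (rule wellorder_InfI)
  then show ?thesis using that assms by auto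
qed

lemma girth_le: "is_cycle E c \<Longrightarrow> girth E \<le> enat (length c)"
  unfolding girth_def by (rule INF_lower) simp

locale flat_graph = graph +
  assumes girth4: "girth E = 4"
    and flat: "ricci_flat V E"
    and unique4: "no_vertex_on_two_4cycles V E"
begin

lemma triangle_free:
  assumes "y \<in> N x" "z \<in> N y"
  shows "z \<notin> N x"
proof
  assume "z \<in> N x"
  then have "is_cycle E [x, y, z]"
    using assms N_irrefl[of x] N_irrefl[of y] N_irrefl[of z] N_sym[of z x]
    by (auto simp: is_cycle3 nbrs_def)
  from girth_le[OF this] show False using girth4 by (simp add: numeral_eq_enat)
qed

lemma square_exists: obtains x y z t where "square E x y z t"
proof -
  obtain c where "is_cycle E c" "length c = 4"
    using girth_attained[of E 4] girth4 by (auto simp: numeral_eq_enat)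
  then show ?thesis using that cycle_square length_eq_4_iff by metis
qed

text \<open>The hypothesis compares cycles by their edge sets. The edges at \<open>x\<close> give
  back its two cycle neighbours, and the union of all edges gives back the vertex set, which leaves
  only the opposite corner.\<close>

lemma square_unique:
  assumes s: "square E x y z t" and s': "square E x y' z' t'"
  shows "z' = z" "{y', t'} = {y, t}"
proof -
  have "x \<in> V" using s N_V by (auto simp: square_def)
  then have "cycle_edges c = cycle_edges c'"
    if "is_cycle E c" "length c = 4" "x \<in> set c" "is_cycle E c'" "length c' = 4" "x \<in> set c'" for c c'
    using unique4 that unfolding no_vertex_on_two_4cycles_def by blast
  from this[OF square_cycle[OF s N_irrefl] _ _ square_cycle[OF s' N_irrefl]]
  have "cycle_edges [x, y, z, t] = cycle_edges [x, y', z', t']" by simp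
  then have eq: "{{x, y}, {y, z}, {z, t}, {t, x}} = {{x, y'}, {y', z'}, {z', t'}, {t', x}}"
    by (simp add: cycle_edges4)
  have d: "distinct [x, y, z, t]" "distinct [x, y', z', t']"
    using square_cycle[OF s N_irrefl] square_cycle[OF s' N_irrefl] by (auto simp: is_cycle_def)
  have "{v. {x, v} \<in> {{x, y}, {y, z}, {z, t}, {t, x}}} = {y, t}"
    using d by (auto simp: doubleton_eq_iff)
  moreover have "{v. {x, v} \<in> {{x, y'}, {y', z'}, {z', t'}, {t', x}}} = {y', t'}"
    using d by (auto simp: doubleton_eq_iff)
  ultimately show nb: "{y', t'} = {y, t}" using eq by simp
  have "\<Union>{{x, y}, {y, z}, {z, t}, {t, x}} = {x, y, z, t}" by auto
  moreover have "\<Union>{{x, y'}, {y', z'}, {z', t'}, {t', x}} = {x, y', z', t'}" by auto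
  ultimately have "{x, y, z, t} = {x, y', z', t'}" using eq by simp
  then have "z' \<in> {x, y, z, t}" by simp
  with nb d show "z' = z" by (auto simp: doubleton_eq_iff)
qed

lemma couplings_nonempty:
  assumes "N x \<noteq> {}" "N y \<noteq> {}" "0 \<le> \<alpha>" "\<alpha> \<le> 1"
  shows "couplings V (walk_measure E \<alpha> x) (walk_measure E \<alpha> y) \<noteq> {}"
proof -
  have "walk_measure E \<alpha> z u \<ge> 0" for z u
    using assms by (simp add: walk_measure_def)
  then show ?thesis
    using product_coupling[OF _ _ walk_measure_has_sum walk_measure_has_sum] assms by blast
qed

lemma edge_parts:
  assumes "y \<in> N x"
  shows "x \<in> N y" "x \<noteq> y" "x \<in> V" "y \<in> V" "N x \<noteq> {}" "N y \<noteq> {}"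
    "insert x (N x) \<subseteq> V" "insert y (N y) \<subseteq> V"
    "\<And>a. a \<in> N x - {y} \<Longrightarrow> a \<notin> N y" "\<And>b. b \<in> N y - {x} \<Longrightarrow> b \<notin> N x"
proof -
  show s: "x \<in> N y" using assms N_sym by simp
  show "x \<noteq> y" using assms N_irrefl by auto
  show "x \<in> V" "y \<in> V" using N_V[OF assms] by auto
  show "N x \<noteq> {}" "N y \<noteq> {}" using assms s by auto
  show "insert x (N x) \<subseteq> V" "insert y (N y) \<subseteq> V"
    using N_V(2) \<open>x \<in> V\<close> \<open>y \<in> V\<close> by auto
  show "a \<notin> N y" if "a \<in> N x - {y}" for a
    using triangle_free[of a x y] that assms N_sym by auto
  show "b \<notin> N x" if "b \<in> N y - {x}" for b
    using triangle_free[of y x b] that assms by auto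
qed

text \<open>The potential is \<open>1\<close> at \<open>x\<close>, \<open>0\<close> at \<open>y\<close>, \<open>g\<close> on the other neighbours of \<open>x\<close> and \<open>h\<close> on
  those of \<open>y\<close>. It only has to be 1-Lipschitz between the two supports, so that no extension to
  the whole graph is needed.\<close>

lemma curvature_nonneg:
  assumes xy: "y \<in> N x"
    and g: "\<And>a. a \<in> N x - {y} \<Longrightarrow> g a \<le> 2" and h: "\<And>b. b \<in> N y - {x} \<Longrightarrow> - 1 \<le> h b"
    and gh: "\<And>a b. a \<in> N x - {y} \<Longrightarrow> b \<in> N y - {x} \<Longrightarrow> g a - h b \<le> dist3 E a b"
  shows "(\<Sum>a\<in>N x - {y}. g a) / real (dg x) - (\<Sum>b\<in>N y - {x}. h b) / real (dg y) \<le> 1 + 1 / real (dg y)"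
proof -
  note p = edge_parts[OF xy]
  \<comment> \<open>Absence of triangles makes \<open>N x - {y}\<close> and \<open>N y - {x}\<close>
    disjoint, so the order of the tests is harmless.\<close>
  define f where "f u = (if u = x then 1 else if u = y then 0 else if u \<in> N x then g u else h u)" for u
  have fx: "f x = 1" "f y = 0" using p(2) by (auto simp: f_def)
  have fA: "f a = g a" if "a \<in> N x - {y}" for a using that N_irrefl[of x] by (auto simp: f_def)
  have fB: "f b = h b" if "b \<in> N y - {x}" for b using that N_irrefl[of y] p(10)[OF that] by (auto simp: f_def)
  define SA SB where "SA = (\<Sum>a\<in>N x - {y}. g a)" and "SB = (\<Sum>b\<in>N y - {x}. h b)"
  have sA: "(\<Sum>u\<in>N x. f u) = SA"
    using xy N_finite fA fx by (simp add: sum.remove[of _ y] SA_def)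
  have sB: "(\<Sum>u\<in>N y. f u) = 1 + SB"
    using p(1) N_finite fB fx by (simp add: sum.remove[of _ x] SB_def)
  have lip: "f u - f v \<le> real (gdist V E u v)" if "u \<in> insert x (N x)" "v \<in> insert y (N y)" for u v
  proof -
    have uV: "u \<in> V" using that(1) p(7) by blast
    have "\<exists>a b. a \<in> N u \<and> b \<in> N a \<and> v \<in> N b" if "u \<in> N x" "v \<in> N y"
      using that xy N_sym by blast
    moreover have "common_nbr E u v" if "u = x" "v \<in> N y" using that xy N_sym by (auto simp: common_nbr_iff)
    moreover have "common_nbr E u v" if "v = y" "u \<in> N x" using that xy N_sym by (auto simp: common_nbr_iff)
    ultimately have gd: "real (gdist V E u v) = dist3 E u v"
      using gdist_eq_dist3[OF uV] that xy by blast
    \<comment> \<open>The bounds \<open>g a \<le> 2\<close> and \<open>- 1 \<le> h b\<close> are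
      exactly what the pairs containing \<open>x\<close> or \<open>y\<close> require;
      \<open>gh\<close> covers the last case.\<close>
    consider "u = x" "v = y" | "u = x" "v = x" | "u = x" "v \<in> N y - {x}"
      | "u = y" "v = y" | "u = y" "v = x" | "u = y" "v \<in> N y - {x}"
      | "u \<in> N x - {y}" "v = y" | "u \<in> N x - {y}" "v = x" | "u \<in> N x - {y}" "v \<in> N y - {x}"
      using \<open>u \<in> insert x (N x)\<close> \<open>v \<in> insert y (N y)\<close> by blast
    then have "f u - f v \<le> dist3 E u v"
    proof cases
      case 3
      then have "dist3 E u v = 2" using p(10)[of v] xy N_sym[of v y] by (auto simp: dist3_def common_nbr_iff)
      then show ?thesis using 3 fx fB[of v] h[of v] by simp
    next
      case 6
      then have "dist3 E u v = 1" using N_irrefl[of y] by (auto simp: dist3_def)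
      then show ?thesis using 6 fx fB[of v] h[of v] by simp
    next
      case 7
      then have "dist3 E u v = 2" using p(1) p(9)[of u] N_sym[of u x] N_sym[of y u] by (auto simp: dist3_def common_nbr_iff)
      then show ?thesis using 7 fx fA[of u] g[of u] by simp
    next
      case 8
      then have "dist3 E u v = 1" using N_irrefl[of x] N_sym[of x u] by (auto simp: dist3_def)
      then show ?thesis using 8 fx fA[of u] g[of u] by simp
    next
      case 9
      then show ?thesis using fA fB gh by simp
    qed (use p(1-2) xy fx in \<open>auto simp: dist3_def\<close>)
    with gd show ?thesis by simp
  qed
  have "has_LLY_curvature V E x y 0"
    using flat xy by (simp add: ricci_flat_def nbrs_def)
  then have "0 \<le> 1 - SA / real (dg x) + (1 + SB) / real (dg y)"
  proof (rule LLY_curvature_le)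
    fix \<epsilon> :: real assume e: "0 < \<epsilon>" "\<epsilon> \<le> 1/2"
    have "(\<Sum>u\<in>insert x (N x). f u * walk_measure E (1 - \<epsilon>) x u) - (\<Sum>v\<in>insert y (N y). f v * walk_measure E (1 - \<epsilon>) y v)
        \<le> wasserstein V E (walk_measure E (1 - \<epsilon>) x) (walk_measure E (1 - \<epsilon>) y)"
    proof (rule wasserstein_ge)
      show "couplings V (walk_measure E (1 - \<epsilon>) x) (walk_measure E (1 - \<epsilon>) y) \<noteq> {}"
        using couplings_nonempty[OF p(5,6)] e by simp
    qed (use p(7,8) lip N_finite in \<open>auto simp: walk_measure_def\<close>)
    then show "1 - \<epsilon> * (1 - SA / real (dg x) + (1 + SB) / real (dg y))
        \<le> wasserstein V E (walk_measure E (1 - \<epsilon>) x) (walk_measure E (1 - \<epsilon>) y)"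
      by (simp add: walk_measure_sum p(3,4) fx sA sB algebra_simps)
  qed
  then show ?thesis by (simp add: SA_def SB_def add_divide_distrib)
qed

text \<open>Besides \<open>\<pi>\<close>, the transport plan leaves the mass common to both measures at \<open>x\<close> and \<open>y\<close>,
  fills the deficit at the neighbours of \<open>y\<close> from \<open>x\<close> at distance \<open>2\<close>, and moves the rest from
  \<open>x\<close> to \<open>y\<close>.\<close>

lemma curvature_nonpos:
  assumes xy: "y \<in> N x"
    and \<pi>: "\<And>a b. a \<in> N x - {y} \<Longrightarrow> b \<in> N y - {x} \<Longrightarrow> 0 \<le> \<pi> a b"
    and row: "\<And>a. a \<in> N x - {y} \<Longrightarrow> (\<Sum>b\<in>N y - {x}. \<pi> a b) = 1 / real (dg x)"
    and col: "\<And>b. b \<in> N y - {x} \<Longrightarrow> (\<Sum>a\<in>N x - {y}. \<pi> a b) \<le> 1 / real (dg y)"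
  shows "1 - 1 / real (dg x) + 2 / real (dg y) \<le>
    (\<Sum>a\<in>N x - {y}. \<Sum>b\<in>N y - {x}. dist3 E a b * \<pi> a b)"
proof -
  note p = edge_parts[OF xy]
  define A B where "A = N x - {y}" and "B = N y - {x}"
  have fin: "finite A" "finite B" by (auto simp: A_def B_def N_finite)
  have NA: "N x = insert y A" "y \<notin> A" "x \<notin> A" using xy N_irrefl[of x] by (auto simp: A_def)
  have NB: "N y = insert x B" "x \<notin> B" "y \<notin> B" using p(1) N_irrefl[of y] by (auto simp: B_def)
  have AV: "A \<subseteq> V" "B \<subseteq> V" using p(7,8) by (auto simp: A_def B_def)
  have dx: "real (dg x) = 1 + real (card A)" using NA fin by simp
  have dy: "real (dg y) = 1 + real (card B)" using NB fin by simp
  have pos: "real (dg x) > 0" "real (dg y) > 0" unfolding dx dy by auto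
  define rest where "rest b = 1 / real (dg y) - (\<Sum>a\<in>A. \<pi> a b)" for b
  have rest0: "rest b \<ge> 0" if "b \<in> B" for b using col that by (simp add: rest_def A_def B_def)
  have mass: "(\<Sum>b\<in>B. \<Sum>a\<in>A. \<pi> a b) = 1 - 1 / real (dg x)"
  proof -
    have "(\<Sum>b\<in>B. \<Sum>a\<in>A. \<pi> a b) = (\<Sum>a\<in>A. 1 / real (dg x))"
      using row by (subst sum.swap) (simp add: A_def B_def)
    also have "\<dots> = 1 - 1 / real (dg x)" using pos dx by (simp add: field_simps)
    finally show ?thesis .
  qed
  have rest_sum: "(\<Sum>b\<in>B. rest b) = 1 / real (dg x) - 1 / real (dg y)"
  proof -
    have "(\<Sum>b\<in>B. rest b) = real (card B) / real (dg y) - (1 - 1 / real (dg x))"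
      using mass by (simp add: rest_def sum_subtractf)
    also have "\<dots> = 1 / real (dg x) - 1 / real (dg y)" using pos dy by (simp add: field_simps)
    finally show ?thesis .
  qed
  define C where "C = (\<Sum>a\<in>A. \<Sum>b\<in>B. dist3 E a b * \<pi> a b)"
  have "has_LLY_curvature V E x y 0"
    using flat xy by (simp add: ricci_flat_def nbrs_def)
  then have "1 - 1 / real (dg x) + 2 / real (dg y) - C \<le> 0"
  proof (rule LLY_curvature_ge)
    fix \<epsilon> :: real assume e: "0 < \<epsilon>" "\<epsilon> \<le> 1/2"
    \<comment> \<open>Of the mass 1 - \<epsilon> at \<open>x\<close>, a part \<epsilon> /
      \<open>dg y\<close> stays and \<epsilon> (1 / \<open>dg x\<close> - 1 / \<open>dg y\<close>)
      fills the deficits; what remains for \<open>y\<close> is 1 - \<epsilon> - \<epsilon> /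
      \<open>dg x\<close>.\<close>
    define X where "X u v = (if u \<in> A \<and> v \<in> B then \<epsilon> * \<pi> u v else if u = x \<and> v \<in> B then \<epsilon> * rest v
      else if u = x \<and> v = y then 1 - \<epsilon> - \<epsilon> / real (dg x) else if u = x \<and> v = x then \<epsilon> / real (dg y)
      else if u = y \<and> v = y then \<epsilon> / real (dg x) else 0)" for u v
    let ?S = "insert x (insert y A)" and ?T = "insert y (insert x B)"
    have XAB: "X a b = \<epsilon> * \<pi> a b" if "a \<in> A" "b \<in> B" for a b using that by (simp add: X_def)
    have XA: "X a y = 0" "X a x = 0" if "a \<in> A" for a using that NA(2,3) NB(2,3) by (auto simp: X_def)
    have Xx: "X x y = 1 - \<epsilon> - \<epsilon> / real (dg x)" "X x x = \<epsilon> / real (dg y)"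
      using NA(2,3) NB(2,3) p(2) by (auto simp: X_def)
    have XxB: "X x b = \<epsilon> * rest b" if "b \<in> B" for b using NA that by (auto simp: X_def)
    have Xy: "X y y = \<epsilon> / real (dg x)" "X y x = 0"
      using NA(2,3) NB(2,3) p(2) by (auto simp: X_def)
    have XyB: "X y b = 0" if "b \<in> B" for b using NA(2,3) NB(2,3) p(2) that by (auto simp: X_def)
    have Xout: "X u v = 0" if "u \<notin> ?S \<or> v \<notin> ?T" for u v
      using that by (auto simp: X_def)
    have sumT: "(\<Sum>v\<in>?T. F v) = F y + F x + (\<Sum>b\<in>B. F b)" for F :: "'a \<Rightarrow> real"
      using NB(2,3) p(2) fin by simp
    have sumS: "(\<Sum>v\<in>?S. F v) = F x + F y + (\<Sum>a\<in>A. F a)" for F :: "'a \<Rightarrow> real"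
      using NA(2,3) p(2) fin by simp
    \<comment> \<open>Here \<epsilon> \<le> 1/2 matters: the mass sent from \<open>x\<close> to
      \<open>y\<close> is at least 1 - 2 \<epsilon>, hence nonnegative.\<close>
    have "\<epsilon> / real (dg x) \<le> \<epsilon>" using e pos dx by (simp add: divide_le_eq)
    then have nn: "X u v \<ge> 0" for u v
      using e pos \<pi> rest0 by (auto simp: X_def A_def B_def)
    have rowX: "(\<Sum>v\<in>?T. X u v) = walk_measure E (1 - \<epsilon>) x u" for u
    proof -
      consider "u = x" | "u = y" | "u \<in> A" | "u \<notin> ?S" by blast
      then show ?thesis
      proof cases
        case 1
        then show ?thesis unfolding sumT
          using rest_sum by (simp add: Xx XxB walk_measure_def right_diff_distrib flip: sum_distrib_left)
      next
        case 2
        then show ?thesis unfolding sumT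
          using p(1,2) xy by (simp add: Xy XyB walk_measure_def)
      next
        case 3
        then have "(\<Sum>b\<in>B. X u b) = \<epsilon> * (1 / real (dg x))"
          using row[of u] by (simp add: XAB A_def B_def flip: sum_distrib_left)
        moreover have "u \<noteq> x" "u \<in> N x" using 3 NA by auto
        ultimately show ?thesis unfolding sumT
          using 3 by (simp add: XA walk_measure_def)
      next
        case 4
        then have "u \<noteq> x" "u \<notin> N x" using NA by auto
        with 4 show ?thesis by (simp add: Xout walk_measure_def)
      qed
    qed
    have colX: "(\<Sum>u\<in>?S. X u v) = walk_measure E (1 - \<epsilon>) y v" for v
    proof -
      consider "v = x" | "v = y" | "v \<in> B" | "v \<notin> ?T" by blast
      then show ?thesis
      proof cases
        case 1
        then show ?thesis unfolding sumS
          using p(1,2) by (simp add: Xx Xy XA walk_measure_def)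
      next
        case 2
        then show ?thesis unfolding sumS
          using p(1,2) xy by (simp add: Xx Xy XA walk_measure_def)
      next
        case 3
        then have "v \<noteq> y" "v \<in> N y" using NB by auto
        with 3 show ?thesis unfolding sumS
          by (simp add: XAB XxB XyB walk_measure_def rest_def right_diff_distrib flip: sum_distrib_left)
      next
        case 4
        then have "v \<noteq> y" "v \<notin> N y" using NB by auto
        with 4 show ?thesis by (simp add: Xout walk_measure_def)
      qed
    qed
    have ST: "finite ?S" "?S \<subseteq> V" "finite ?T" "?T \<subseteq> V" using fin AV p(3,4) by auto
    have "X \<in> couplings V (walk_measure E (1 - \<epsilon>) x) (walk_measure E (1 - \<epsilon>) y)"
      unfolding couplings_def
    proof (intro CollectI conjI ballI)
      show "(X u has_sum walk_measure E (1 - \<epsilon>) x u) V" for u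
        by (rule has_sum_finite_neutralI[OF ST(3,4)]) (simp_all add: Xout rowX del: sum.insert insert_iff)
      show "((\<lambda>u. X u v) has_sum walk_measure E (1 - \<epsilon>) y v) V" for v
        by (rule has_sum_finite_neutralI[OF ST(1,2)]) (simp_all add: Xout colX del: sum.insert insert_iff)
    qed (rule nn)
    from wasserstein_le[OF this ST Xout]
    have "wasserstein V E (walk_measure E (1 - \<epsilon>) x) (walk_measure E (1 - \<epsilon>) y)
        \<le> (\<Sum>u\<in>?S. \<Sum>v\<in>?T. real (gdist V E u v) * X u v)" .
    also have "\<dots> = (1 - \<epsilon> - \<epsilon> / real (dg x)) + (\<Sum>b\<in>B. 2 * (\<epsilon> * rest b))
        + (\<Sum>a\<in>A. \<Sum>b\<in>B. dist3 E a b * (\<epsilon> * \<pi> a b))"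
    proof -
      have "real (gdist V E x y) = 1" "real (gdist V E x x) = 0" "real (gdist V E y y) = 0"
        using gdist_eq_dist3[of x y] gdist_eq_dist3[of x x] gdist_eq_dist3[of y y] p(2-4) xy
        by (auto simp: dist3_def)
      moreover have "real (gdist V E x b) = 2" if "b \<in> B" for b
      proof -
        have b: "b \<in> N y - {x}" using that by (simp add: B_def)
        then have "common_nbr E x b" using xy N_sym[of b y] by (auto simp: common_nbr_iff)
        then show ?thesis using gdist_eq_dist3[of x b] p(3) p(10)[OF b] b by (auto simp: dist3_def)
      qed
      moreover have "real (gdist V E a b) = dist3 E a b" if "a \<in> A" "b \<in> B" for a b
      proof (rule gdist_eq_dist3)
        show "a \<in> V" using that AV by blast
        have "x \<in> N a" "y \<in> N x" "b \<in> N y" using that xy N_sym[of a x] by (auto simp: A_def B_def)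
        then show "a = b \<or> b \<in> N a \<or> common_nbr E a b \<or> (\<exists>a' b'. a' \<in> N a \<and> b' \<in> N a' \<and> b \<in> N b')"
          by blast
      qed
      ultimately show ?thesis
        unfolding sumS sumT by (simp add: Xx Xy XA XxB XyB XAB)
    qed
    also have "\<dots> = (1 - \<epsilon> - \<epsilon> / real (dg x)) + 2 * \<epsilon> * (\<Sum>b\<in>B. rest b) + \<epsilon> * C"
      by (simp add: C_def sum_distrib_left sum_distrib_right mult_ac)
    also have "\<dots> = 1 - \<epsilon> * (1 - 1 / real (dg x) + 2 / real (dg y) - C)"
      unfolding rest_sum by (simp add: algebra_simps)
    finally show "wasserstein V E (walk_measure E (1 - \<epsilon>) x) (walk_measure E (1 - \<epsilon>) y)
        \<le> 1 - \<epsilon> * (1 - 1 / real (dg x) + 2 / real (dg y) - C)" .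
  qed
  then show ?thesis by (simp add: C_def A_def B_def)
qed

section \<open>Local structure at an edge\<close>

text \<open>Testing squares that start with \<open>x\<close>, \<open>y\<close> suffices: any 4-cycle
  through the edge can be rotated and reflected into that form.\<close>

definition free_edge :: "'a \<Rightarrow> 'a \<Rightarrow> bool" where
  "free_edge x y \<longleftrightarrow> y \<in> N x \<and> (\<forall>a b. \<not> square E x y b a)"

lemma free_edge_edge: "free_edge x y \<Longrightarrow> y \<in> N x"
  by (simp add: free_edge_def)

lemma edge_squareI:
  assumes "y \<in> N x" "a \<in> N x - {y}" "b \<in> N y - {x}" "b \<in> N a"
  shows "square E x y b a"
  using assms N_sym[of a b] N_sym[of x a] unfolding square_def by auto

lemma dist3_free_edge:
  assumes "free_edge x y" "a \<in> N x - {y}" "b \<in> N y - {x}"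
  shows "dist3 E a b = (if common_nbr E a b then 2 else 3)"
proof -
  have "b \<notin> N a" using assms edge_squareI free_edge_def by blast
  moreover have "a \<noteq> b" using edge_parts(9)[OF free_edge_edge[OF assms(1)] assms(2)] assms(3) by blast
  ultimately show ?thesis by (simp add: dist3_def)
qed

lemma square_edges:
  assumes "square E x y z t"
  shows "y \<in> N x" "t \<in> N x" "x \<in> N y" "z \<in> N y" "y \<in> N z" "t \<in> N z" "z \<in> N t" "x \<in> N t"
    "x \<noteq> z" "y \<noteq> t" "distinct [x, y, z, t]"
proof -
  show n: "y \<in> N x" "z \<in> N y" "t \<in> N z" "x \<in> N t" "x \<noteq> z" "y \<noteq> t"
    using assms by (auto simp: square_def)
  then show "t \<in> N x" "x \<in> N y" "y \<in> N z" "z \<in> N t" using N_sym by blast+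
  show "distinct [x, y, z, t]"
    using n N_irrefl[of x] N_irrefl[of y] N_irrefl[of z] N_irrefl[of t] by auto
qed

lemma square_rot: "square E x y z t \<Longrightarrow> square E y z t x"
  by (auto simp: square_def)

lemma square_flip:
  assumes "square E x y z t"
  shows "square E y x t z"
  using square_edges[OF assms] unfolding square_def by simp

text \<open>Any adjacent outer pair would close a 4-cycle through \<open>x\<close>, so it must be
  the pair already known.\<close>

lemma square_second:
  assumes "square E x y z t" "a \<in> N x - {y}" "b \<in> N y - {x}" "b \<in> N a"
  shows "a = t" "b = z"
proof -
  have "square E x y b a" by (rule edge_squareI[OF square_edges(1)[OF assms(1)] assms(2-4)])
  from square_unique[OF assms(1) this] assms(2) show "a = t" "b = z"
    by (auto simp: doubleton_eq_iff)
qed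

lemma dist3_square:
  assumes "square E x y z t" "a \<in> N x - {y}" "b \<in> N y - {x}"
  shows "dist3 E a b = (if a = t \<and> b = z then 1 else if common_nbr E a b then 2 else 3)"
proof -
  note s = square_edges[OF assms(1)]
  have "b \<in> N a \<longleftrightarrow> a = t \<and> b = z" using square_second[OF assms] s(7) by blast
  moreover have "a \<noteq> b" using edge_parts(9)[OF s(1) assms(2)] assms(3) by blast
  ultimately show ?thesis by (simp add: dist3_def)
qed

text \<open>At a leaf there is no outer mass to move, and the empty plan already makes the curvature
  at least 2 / \<open>dg y\<close>.\<close>

lemma deg_gt_1:
  assumes "y \<in> N x"
  shows "dg x > 1"
proof (rule ccontr)
  assume "\<not> 1 < dg x"
  moreover have "dg x > 0" using assms N_finite by (auto simp: card_gt_0_iff)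
  ultimately have x: "dg x = 1" by simp
  then have A: "N x - {y} = {}" using assms by (auto simp: card_1_singleton_iff)
  have yx: "x \<in> N y" using assms N_sym by simp
  then have "dg y > 0" using N_finite by (auto simp: card_gt_0_iff)
  with curvature_nonpos[OF assms, of "\<lambda>_ _. 0"] show False
    by (simp add: x A)
qed

text \<open>All outer pairs are at distance at least 2, so the potential 1 on the side of
  \<open>x\<close> and -1 on the side of \<open>y\<close> is admissible.\<close>

lemma free_edge_sum:
  assumes "free_edge x y"
  shows "1 \<le> 1 / real (dg x) + 2 / real (dg y)"
proof -
  have yx: "y \<in> N x" "x \<in> N y" using free_edge_edge[OF assms] N_sym by auto
  have pos: "dg x > 1" "dg y > 1" using deg_gt_1 yx by auto
  have A: "card (N x - {y}) = dg x - 1" and B: "card (N y - {x}) = dg y - 1"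
    using yx by simp_all
  have "(\<Sum>a\<in>N x - {y}. 1) / real (dg x) - (\<Sum>b\<in>N y - {x}. - 1) / real (dg y) \<le> 1 + 1 / real (dg y)"
    by (rule curvature_nonneg[OF yx(1)]) (use dist3_free_edge[OF assms] in auto)
  then show ?thesis using pos by (simp add: A B of_nat_diff diff_divide_distrib)
qed

lemma free_edge_sym: "free_edge x y \<Longrightarrow> free_edge y x"
  using square_flip N_sym unfolding free_edge_def by blast

text \<open>The sum inequality is used in both directions. In terms of the excesses p, q of the
  degrees over 2 it says that p(q+1) and q(p+1) are at most 2, which leaves few solutions.\<close>

lemma free_edge_deg:
  assumes "free_edge x y"
  shows "dg x = 2 \<and> dg y \<in> {2, 3, 4} \<or> dg x = 3 \<and> dg y \<in> {2, 3} \<or> dg x = 4 \<and> dg y = 2"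
proof -
  have pos: "dg x > 1" "dg y > 1"
    using deg_gt_1 free_edge_edge[OF assms] free_edge_edge[OF free_edge_sym[OF assms]] by auto
  have *: "real (dg x) * real (dg y) \<le> real (dg y) + 2 * real (dg x)"
    "real (dg x) * real (dg y) \<le> real (dg x) + 2 * real (dg y)"
    using free_edge_sum[OF assms] free_edge_sum[OF free_edge_sym[OF assms]] pos by (simp_all add: field_simps)
  have **: "dg x * dg y \<le> dg y + 2 * dg x" "dg x * dg y \<le> dg x + 2 * dg y"
    unfolding of_nat_le_iff[where 'a = real, symmetric] using * by simp_all
  obtain p q where pq: "dg x = p + 2" "dg y = q + 2"
    using pos by (metis One_nat_def Suc_1 Suc_leI less_eqE add.commute)
  have 1: "p * q + p \<le> 2" "p * q + q \<le> 2" using ** unfolding pq by (simp_all add: algebra_simps)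
  then have "p \<le> 2" "q \<le> 2" by linarith+
  then have "p = 0 \<or> p = 1 \<or> p = 2" "q = 0 \<or> q = 1 \<or> q = 2" by linarith+
  with 1 show ?thesis unfolding pq by auto
qed

text \<open>Moving mass 1/2 over distance 2 costs 1, while by \<open>curvature_nonpos\<close> zero
  curvature demands a cost of at least 3/2.\<close>

lemma free_edge_2_2:
  assumes "free_edge x y" and N: "N x = {y, u}" "N y = {x, v}" "u \<noteq> y" "v \<noteq> x"
  shows "\<not> common_nbr E u v"
proof
  assume common_nbr: "common_nbr E u v"
  have A: "N x - {y} = {u}" "dg x = 2" and B: "N y - {x} = {v}" "dg y = 2" using N by auto
  have d: "dist3 E u v = 2" using dist3_free_edge[OF assms(1)] A B common_nbr by simp
  have "1 - 1 / real (dg x) + 2 / real (dg y) \<le>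
    (\<Sum>a\<in>N x - {y}. \<Sum>b\<in>N y - {x}. dist3 E a b * (\<lambda>_ _. 1/2) a b)"
    by (rule curvature_nonpos[OF free_edge_edge[OF assms(1)]]) (simp_all add: A B)
  then show False by (simp add: A B d)
qed

text \<open>Were both pairs at distance 2, splitting the mass 1/2 evenly would cost 1, below the
  demanded 7/6. Were both at distance 3, the potential 2 at \<open>u\<close> and -1 at
  \<open>v\<close>, \<open>w\<close> would give 5/3 where \<open>curvature_nonneg\<close> allows
  4/3.\<close>

lemma free_edge_2_3:
  assumes "free_edge x y" and N: "N x = {y, u}" "N y = {x, v, w}" "u \<noteq> y" "distinct [x, v, w]"
  shows "common_nbr E u v \<longleftrightarrow> \<not> common_nbr E u w"
proof -
  have A: "N x - {y} = {u}" "dg x = 2" and B: "N y - {x} = {v, w}" "dg y = 3" using N by auto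
  have d: "dist3 E u v = (if common_nbr E u v then 2 else 3)" "dist3 E u w = (if common_nbr E u w then 2 else 3)"
    using dist3_free_edge[OF assms(1)] A B by auto
  have "\<not> (common_nbr E u v \<and> common_nbr E u w)"
  proof
    assume c: "common_nbr E u v \<and> common_nbr E u w"
    have "1 - 1 / real (dg x) + 2 / real (dg y) \<le>
      (\<Sum>a\<in>N x - {y}. \<Sum>b\<in>N y - {x}. dist3 E a b * (\<lambda>_ _. 1/4) a b)"
      by (rule curvature_nonpos[OF free_edge_edge[OF assms(1)]]) (use N in \<open>simp_all add: A B\<close>)
    then show False using c N by (simp add: A B d)
  qed
  moreover have "common_nbr E u v \<or> common_nbr E u w"
  proof (rule ccontr)
    assume c: "\<not> (common_nbr E u v \<or> common_nbr E u w)"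
    have "(\<Sum>a\<in>N x - {y}. 2) / real (dg x) - (\<Sum>b\<in>N y - {x}. - 1) / real (dg y) \<le> 1 + 1 / real (dg y)"
      by (rule curvature_nonneg[OF free_edge_edge[OF assms(1)]]) (use c d in \<open>auto simp: A B\<close>)
    then show False using N by (simp add: A B)
  qed
  ultimately show ?thesis by blast
qed

text \<open>Otherwise the potential 2 at \<open>u\<close>, -1 at \<open>v\<close> and
  \<open>w\<close>, 0 at \<open>s\<close> would give 3/2 against the allowed 5/4. As
  \<open>v\<close>, \<open>w\<close> may be any two of the three, at most one of them fails to share
  a neighbour with \<open>u\<close>.\<close>

lemma free_edge_2_4:
  assumes "free_edge x y" and N: "N x = {y, u}" "N y = {x, v, w, s}" "u \<noteq> y" "distinct [x, v, w, s]"
  shows "common_nbr E u v \<or> common_nbr E u w"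
proof (rule ccontr)
  assume c: "\<not> (common_nbr E u v \<or> common_nbr E u w)"
  have A: "N x - {y} = {u}" "dg x = 2" and B: "N y - {x} = {v, w, s}" "dg y = 4" using N by auto
  have d: "dist3 E u v = 3" "dist3 E u w = 3" "dist3 E u s \<ge> 2"
    using dist3_free_edge[OF assms(1)] A B c by auto
  have "(\<Sum>a\<in>N x - {y}. 2) / real (dg x) - (\<Sum>b\<in>N y - {x}. if b = s then 0 else - 1) / real (dg y)
      \<le> 1 + 1 / real (dg y)"
    by (rule curvature_nonneg[OF free_edge_edge[OF assms(1)]]) (use d in \<open>auto simp: A B\<close>)
  then show False using N by (simp add: A B)
qed

text \<open>Otherwise the potential 2 at \<open>u\<close>, 1 at \<open>u'\<close> and -1 at
  \<open>v\<close>, \<open>v'\<close> would give 5/3 against the allowed 4/3.\<close>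

lemma free_edge_3_3:
  assumes "free_edge x y" and N: "N x = {y, u, u'}" "N y = {x, v, v'}" "distinct [y, u, u']" "distinct [x, v, v']"
  shows "common_nbr E u v \<or> common_nbr E u v'"
proof (rule ccontr)
  assume c: "\<not> (common_nbr E u v \<or> common_nbr E u v')"
  have A: "N x - {y} = {u, u'}" "dg x = 3" and B: "N y - {x} = {v, v'}" "dg y = 3" using N by auto
  have d: "dist3 E u v = 3" "dist3 E u v' = 3" "dist3 E u' v \<ge> 2" "dist3 E u' v' \<ge> 2"
    using dist3_free_edge[OF assms(1)] A B c by auto
  have "(\<Sum>a\<in>N x - {y}. if a = u then 2 else 1) / real (dg x) - (\<Sum>b\<in>N y - {x}. - 1) / real (dg y)
      \<le> 1 + 1 / real (dg y)"
    by (rule curvature_nonneg[OF free_edge_edge[OF assms(1)]]) (use d in \<open>auto simp: A B\<close>)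
  then show False using N by (auto simp: A B)
qed

text \<open>The adjacent pair \<open>t\<close>, \<open>z\<close> makes transport too cheap. For
  degree 2 of \<open>y\<close> the cost is 1/2 against a demand of 3/2. For degree 3,
  \<open>z\<close> takes its full capacity 1/3 and \<open>v\<close> the remaining 1/6, at cost at
  most 5/6 against 7/6.\<close>

lemma square_2_deg_ge_4:
  assumes sq: "square E x y z t" and "dg x = 2"
  shows "dg y \<ge> 4"
proof (rule ccontr)
  note s = square_edges[OF sq]
  have "{y, t} = N x"
    by (rule card_subset_eq[OF N_finite]) (use s assms in auto)
  then have A: "N x - {y} = {t}" using s by auto
  assume "\<not> 4 \<le> dg y"
  moreover have "dg y \<ge> 2" using deg_gt_1[OF s(3)] by simp
  ultimately consider "dg y = 2" | "dg y = 3" by linarith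
  then show False
  proof cases
    case 1
    have "{x, z} = N y"
      by (rule card_subset_eq[OF N_finite]) (use s 1 in auto)
    then have B: "N y - {x} = {z}" using s by auto
    have d: "dist3 E t z = 1" using dist3_square[OF sq, of t z] A B by auto
    have "1 - 1 / real (dg x) + 2 / real (dg y) \<le>
      (\<Sum>a\<in>N x - {y}. \<Sum>b\<in>N y - {x}. dist3 E a b * (\<lambda>_ _. 1/2) a b)"
      by (rule curvature_nonpos[OF s(1)]) (use assms 1 in \<open>simp_all add: A B\<close>)
    then show False by (simp add: A B d assms 1)
  next
    case 2
    have "card (N y - {x, z}) = 1" using 2 s by (simp add: card_Diff_subset)
    then obtain v where v: "N y - {x, z} = {v}" by (auto simp: card_1_singleton_iff)
    then have B: "N y - {x} = {z, v}" "z \<noteq> v" using s by auto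
    have d: "dist3 E t z = 1" "dist3 E t v \<le> 3" using dist3_square[OF sq, of t] A B by auto
    have "1 - 1 / real (dg x) + 2 / real (dg y) \<le>
      (\<Sum>a\<in>N x - {y}. \<Sum>b\<in>N y - {x}. dist3 E a b * (\<lambda>a b. if b = z then 1/3 else 1/6) a b)"
      by (rule curvature_nonpos[OF s(1)]) (use assms 2 B in \<open>auto simp: A\<close>)
    then show False using B d by (simp add: A assms 2)
  qed
qed

text \<open>Splitting the mass 1/2 of \<open>t\<close> between \<open>z\<close> at distance 1 and
  \<open>v\<close> at distance 2 would cost 3/4, below the demanded 1; \<open>w\<close> is then
  filled from \<open>x\<close>.\<close>

lemma square_2_4:
  assumes sq: "square E x y z t"
    and N: "N x = {y, t}" "N y = {x, z, v, w}" "distinct [x, z, v, w]"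
  shows "\<not> common_nbr E t v"
proof
  assume c: "common_nbr E t v"
  note s = square_edges[OF sq]
  have A: "N x - {y} = {t}" "dg x = 2" and B: "N y - {x} = {z, v, w}" "dg y = 4" using N s(10) by auto
  have d: "dist3 E t z = 1" "dist3 E t v = 2" using dist3_square[OF sq, of t] A B c N by auto
  have "1 - 1 / real (dg x) + 2 / real (dg y) \<le>
    (\<Sum>a\<in>N x - {y}. \<Sum>b\<in>N y - {x}. dist3 E a b * (\<lambda>a b. if b = w then 0 else 1/4) a b)"
    by (rule curvature_nonpos[OF s(1)]) (use N(3-) in \<open>auto simp: A B\<close>)
  then show False using d N(3-) by (auto simp: A B)
qed

text \<open>Matching \<open>t\<close> with \<open>z\<close> and \<open>u\<close> with
  \<open>v\<close> would cost 1/3 + 2/3, below the demanded 4/3.\<close>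

lemma square_3_3:
  assumes sq: "square E x y z t"
    and N: "N x = {y, t, u}" "N y = {x, z, v}" "distinct [y, t, u]" "distinct [x, z, v]"
  shows "\<not> common_nbr E u v"
proof
  assume c: "common_nbr E u v"
  note s = square_edges[OF sq]
  have A: "N x - {y} = {t, u}" "dg x = 3" and B: "N y - {x} = {z, v}" "dg y = 3" using N s(10) by auto
  have d: "dist3 E t z = 1" "dist3 E u v = 2" using dist3_square[OF sq] A B c N by auto
  have "1 - 1 / real (dg x) + 2 / real (dg y) \<le>
    (\<Sum>a\<in>N x - {y}. \<Sum>b\<in>N y - {x}. dist3 E a b * (\<lambda>a b. if (a = t) = (b = z) then 1/3 else 0) a b)"
    by (rule curvature_nonpos[OF s(1)]) (use N(3-) in \<open>auto simp: A B\<close>)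
  then show False using d N(3-) by (auto simp: A B)
qed

text \<open>Otherwise the potential 2 at \<open>u\<close>, 1 at \<open>t\<close> and
  \<open>u'\<close>, 0 at \<open>z\<close>, -1 at \<open>v\<close>, \<open>v'\<close> would give 3/2
  against the allowed 5/4.\<close>

lemma square_4_4:
  assumes sq: "square E x y z t"
    and N: "N x = {y, t, u, u'}" "N y = {x, z, v, v'}" "distinct [y, t, u, u']" "distinct [x, z, v, v']"
  shows "common_nbr E u v \<or> common_nbr E u v'"
proof (rule ccontr)
  assume c: "\<not> (common_nbr E u v \<or> common_nbr E u v')"
  note s = square_edges[OF sq]
  have A: "N x - {y} = {t, u, u'}" "dg x = 4" and B: "N y - {x} = {z, v, v'}" "dg y = 4" using N s(10) by auto
  have d: "dist3 E t z = 1" "dist3 E u v = 3" "dist3 E u v' = 3"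
    "dist3 E u z \<ge> 2" "dist3 E u' z \<ge> 2" "dist3 E t v \<ge> 2" "dist3 E t v' \<ge> 2" "dist3 E u' v \<ge> 2" "dist3 E u' v' \<ge> 2"
    using dist3_square[OF sq] A B c N by auto
  have "(\<Sum>a\<in>N x - {y}. if a = u then 2 else 1) / real (dg x) - (\<Sum>b\<in>N y - {x}. if b = z then 0 else - 1) / real (dg y)
      \<le> 1 + 1 / real (dg y)"
    by (rule curvature_nonneg[OF s(1)]) (use d N(3-) in \<open>auto simp: A B\<close>)
  then show False using N(3-) by (auto simp: A B)
qed

text \<open>Give \<open>t\<close> and \<open>u\<close> the maximal value 2. Then 1, 0, -1 at
  \<open>z\<close>, \<open>v\<close>, \<open>w\<close> respect the distances 1, 2, 3, and the result
  4/3 exceeds the allowed 5/4. The roles of \<open>v\<close> and \<open>w\<close> can be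
  exchanged.\<close>

lemma square_3_4:
  assumes sq: "square E x y z t"
    and N: "N x = {y, t, u}" "N y = {x, z, v, w}" "distinct [y, t, u]" "distinct [x, z, v, w]"
    and t: "\<not> common_nbr E t v" "\<not> common_nbr E t w"
  shows "common_nbr E u w"
proof (rule ccontr)
  assume c: "\<not> common_nbr E u w"
  note s = square_edges[OF sq]
  have A: "N x - {y} = {t, u}" "dg x = 3" and B: "N y - {x} = {z, v, w}" "dg y = 4" using N s(10) by auto
  have d: "dist3 E t z = 1" "dist3 E u w = 3" "dist3 E t v = 3" "dist3 E t w = 3"
    "dist3 E u z \<ge> 2" "dist3 E u v \<ge> 2"
    using dist3_square[OF sq] A B c N t by auto
  have "(\<Sum>a\<in>N x - {y}. 2) / real (dg x) - (\<Sum>b\<in>N y - {x}. if b = z then 1 else if b = v then 0 else - 1) / real (dg y)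
      \<le> 1 + 1 / real (dg y)"
    by (rule curvature_nonneg[OF s(1)]) (use d N(3-) in \<open>auto simp: A B\<close>)
  moreover have "t \<noteq> u" "v \<noteq> z" "w \<noteq> z" "w \<noteq> v" using N(3-) by auto
  ultimately show False by (simp add: A B)
qed

end

section \<open>Degrees on a 4-cycle\<close>

lemma card_2_obtain:
  assumes "card S = 2" "a \<in> S"
  obtains b where "S = {a, b}" "b \<noteq> a"
  using assms by (metis card_2_iff insert_commute insertE singletonD)

lemma card_3_obtain_pair:
  assumes "card S = 3" "a \<in> S" "b \<in> S" "a \<noteq> b"
  obtains c where "S = {a, b, c}" "distinct [a, b, c]"
proof -
  have "card (S - {a, b}) = 1" using assms by (simp add: card_Diff_subset)
  then obtain c where "S - {a, b} = {c}" by (auto simp: card_1_singleton_iff)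
  then have "S = {a, b, c}" "distinct [a, b, c]" using assms by auto
  then show ?thesis using that by blast
qed

lemma card_4_obtain_pair:
  assumes "card S = 4" "a \<in> S" "b \<in> S" "a \<noteq> b"
  obtains c d where "S = {a, b, c, d}" "distinct [a, b, c, d]"
proof -
  have "card (S - {a, b}) = 2" using assms by (simp add: card_Diff_subset)
  then obtain c d where "S - {a, b} = {c, d}" "c \<noteq> d" by (auto simp: card_2_iff)
  then have "S = {a, b, c, d}" "distinct [a, b, c, d]" using assms by auto
  then show ?thesis using that by blast
qed

context flat_graph begin

lemma nbr_closed_eq_V:
  assumes "S \<subseteq> V" "S \<noteq> {}" and closed: "\<And>u. u \<in> S \<Longrightarrow> N u \<subseteq> S"
  shows "S = V"
proof -
  have walk: "set p \<subseteq> S" if "successively (\<lambda>x y. {x, y} \<in> E) p" "p \<noteq> []" "hd p \<in> S" for p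
    using that
  proof (induction p rule: induct_list012)
    case (3 a b p)
    then have "b \<in> N a" by (simp add: nbrs_def)
    with closed[of a] 3 show ?case by auto
  qed auto
  obtain u where u: "u \<in> S" using assms by blast
  have "v \<in> S" if v: "v \<in> V" for v
  proof -
    obtain p where "walk_betw V E u p v"
      using conn u v assms(1) unfolding connected_graph_def by blast
    with walk[of p] u show ?thesis
      unfolding walk_betw_def by (metis last_in_set subsetD)
  qed
  with assms(1) show ?thesis by blast
qed

text \<open>Matching neighbourhoods vertex by vertex is enough: the image of \<open>g\<close> is
  closed under neighbours, hence all of \<open>V\<close> by connectedness, and the isomorphism is
  the inverse of \<open>g\<close>.\<close>

lemma graph_isoI:
  fixes g :: "'b \<Rightarrow> 'a"
  assumes inj: "inj_on g V'" and "V' \<noteq> {}"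
    and nb: "\<And>i. i \<in> V' \<Longrightarrow> N (g i) = g ` nbrs E' i" "\<And>i. i \<in> V' \<Longrightarrow> nbrs E' i \<subseteq> V'"
    and ne: "\<And>i. i \<in> V' \<Longrightarrow> nbrs E' i \<noteq> {}"
  shows "graph_iso V E V' E'"
proof -
  have "g i \<in> V" if "i \<in> V'" for i
    using nb(1)[OF that] ne[OF that] N_V(1) by blast
  then have V: "g ` V' = V"
  proof (intro nbr_closed_eq_V)
    show "N u \<subseteq> g ` V'" if "u \<in> g ` V'" for u
      using that nb by (metis imageE image_mono)
  qed (use \<open>V' \<noteq> {}\<close> in auto)
  have "bij_betw g V' V" using inj V by (simp add: bij_betw_def)
  then have "bij_betw (inv_into V' g) V V'" by (rule bij_betw_inv_into)
  moreover have "{u, v} \<in> E \<longleftrightarrow> {inv_into V' g u, inv_into V' g v} \<in> E'" if uv: "u \<in> V" "v \<in> V" for u v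
  proof -
    obtain i j where ij: "i \<in> V'" "j \<in> V'" "u = g i" "v = g j" using uv V by blast
    have "{u, v} \<in> E \<longleftrightarrow> g j \<in> N (g i)" by (simp add: ij nbrs_def)
    also have "\<dots> \<longleftrightarrow> j \<in> nbrs E' i"
      using nb(1)[OF ij(1)] nb(2)[OF ij(1)] inj ij(2) by (auto dest: inj_onD)
    also have "\<dots> \<longleftrightarrow> {i, j} \<in> E'" by (simp add: nbrs_def)
    finally show ?thesis using ij inj by simp
  qed
  ultimately show ?thesis unfolding graph_iso_def by blast
qed

text \<open>A 4-cycle through an edge leaving the square would be a second one at the corner
  \<open>x\<close>.\<close>

lemma free_edge_square:
  assumes sq: "square E x y z t" and "u \<in> N x" "u \<noteq> y" "u \<noteq> t"
  shows "free_edge x u"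
  unfolding free_edge_def
proof (intro conjI allI notI)
  fix a b assume "square E x u b a"
  from square_unique(2)[OF sq this] assms show False by (auto simp: doubleton_eq_iff)
qed (rule assms)

lemma square_deg:
  assumes sq: "square E x y z t"
  shows "dg x \<in> {2, 3, 4}"
proof (rule ccontr)
  note s = square_edges[OF sq]
  assume n: "dg x \<notin> {2, 3, 4}"
  have "dg x > 1" using deg_gt_1 s(1) by simp
  with n have "dg x > 4" by simp
  moreover have "card {y, t} \<le> 2" by (simp add: card_insert_if)
  ultimately have "\<not> N x \<subseteq> {y, t}"
    using card_mono[of "{y, t}" "N x"] by fastforce
  then obtain u where "u \<in> N x" "u \<noteq> y" "u \<noteq> t" by blast
  from free_edge_deg[OF free_edge_square[OF sq this]] n show False by auto
qed

lemma square_reflect: "square E x y z t \<Longrightarrow> square E x t z y"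
  by (drule square_flip, drule square_rot, simp)

lemma square_2_deg_eq_4:
  assumes sq: "square E x y z t" and x: "dg x = 2"
  shows "dg y = 4"
  using square_2_deg_ge_4[OF assms] square_deg[OF square_rot[OF sq]] by auto

lemma common_nbr_deg2:
  assumes "N v = {y, w}" "u \<notin> N y" 
  shows "common_nbr E u v \<longleftrightarrow> w \<in> N u"
  using assms N_sym[of y u] by (auto simp: common_nbr_iff)

lemma deg2_not_common_nbr:
  assumes sq: "square E x y z t" and x: "dg x = 2" and p: "p \<in> N y - {x, z}"
  shows "\<not> common_nbr E t p"
proof -
  note s = square_edges[OF sq]
  obtain t' where "N x = {y, t'}" "t' \<noteq> y" using card_2_obtain[OF x s(1)] by metis
  with s(2,10) have Nx: "N x = {y, t}" by auto
  obtain v w where Ny: "N y = {x, z, v, w}" "distinct [x, z, v, w]"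
    using card_4_obtain_pair[OF square_2_deg_eq_4[OF sq x] s(3,4,9)] by metis
  have "N y = {x, z, w, v}" "distinct [x, z, w, v]" using Ny by auto
  with square_2_4[OF sq Nx] Ny p show ?thesis by auto
qed

text \<open>The edge \<open>p y\<close> has degrees 2 and 4, so \<open>w\<close> misses at most one
  of \<open>x\<close>, \<open>z\<close>, \<open>q\<close>. It misses \<open>x\<close>: a common
  neighbour would be \<open>t\<close>, making \<open>w\<close> a common neighbour of
  \<open>t\<close> and \<open>p\<close>.\<close>

lemma deg2_outer:
  assumes sq: "square E x y z t" and x: "dg x = 2"
    and p: "p \<in> N y - {x, z}" and q: "q \<in> N y - {x, z}" and pq: "p \<noteq> q"
    and Np: "N p = {y, w}" "w \<noteq> y"
  shows "common_nbr E w z" "common_nbr E w q"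
proof -
  note s = square_edges[OF sq]
  obtain v v' where Ny: "N y = {x, z, v, v'}" "distinct [x, z, v, v']"
    using card_4_obtain_pair[OF square_2_deg_eq_4[OF sq x] s(3,4,9)] by metis
  have N: "N y = {p, x, z, q}" "distinct [p, x, z, q]" "N y = {p, x, q, z}" "distinct [p, x, q, z]"
    using Ny p q pq by auto
  obtain t' where "N x = {y, t'}" "t' \<noteq> y" using card_2_obtain[OF x s(1)] by metis
  with s(2,10) have Nx: "N x = {y, t}" by auto
  have pw: "w \<in> N p" "y \<in> N p" using Np by auto
  have wy: "w \<notin> N y" using triangle_free[of p y w] p pw by blast
  have "\<not> common_nbr E w x"
  proof
    assume "common_nbr E w x"
    then have "t \<in> N w" using common_nbr_deg2[OF Nx wy] by simp
    then have "common_nbr E t p" using pw N_sym[of t w] by (auto simp: common_nbr_iff)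
    then show False using deg2_not_common_nbr[OF sq x p] by simp
  qed
  moreover have "free_edge p y" using free_edge_sym[OF free_edge_square[OF square_rot[OF sq], of p]] p by auto
  ultimately show "common_nbr E w z" "common_nbr E w q"
    using free_edge_2_4[OF _ Np(1) N(1) Np(2) N(2)] free_edge_2_4[OF _ Np(1) N(3) Np(2) N(4)] by auto
qed

lemma outer_deg4:
  assumes sq: "square E x y z t" and x: "dg x = 4" and p: "p \<in> N x - {y, t}"
  obtains w where "N p = {x, w}" "w \<noteq> x" "w \<noteq> y" "w \<noteq> t" "w \<notin> N x" "dg p = 2"
proof -
  have "free_edge x p" using free_edge_square[OF sq, of p] p by auto
  from free_edge_deg[OF this] x have 2: "dg p = 2" by auto
  have "x \<in> N p" using p N_sym by blast
  then obtain w where w: "N p = {x, w}" "w \<noteq> x" using card_2_obtain[OF 2] by metis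
  then have "w \<in> N p" by simp
  then have "w \<notin> N x" using triangle_free[of p x w] p by blast
  with square_edges(1,2)[OF sq] w 2 show ?thesis using that by blast
qed

text \<open>If the two far ends agreed, \<open>x\<close>, \<open>p\<close>, \<open>w\<close>,
  \<open>q\<close> would be another 4-cycle at \<open>x\<close>.\<close>

lemma outer_deg4_distinct:
  assumes sq: "square E x y z t" and p: "p \<in> N x - {y, t}" and q: "q \<in> N x - {y, t}" "p \<noteq> q"
    and w: "w \<in> N p" "w' \<in> N q" "w \<noteq> x"
  shows "w \<noteq> w'"
proof
  assume "w = w'"
  then have "square E x p w q" using p q w N_sym[of w q] N_sym[of x q] by (auto simp: square_def)
  from square_unique(2)[OF sq this] p show False by (auto simp: doubleton_eq_iff)
qed

end

lemma card_3_obtain_member: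
  assumes "card S = 3" "a \<in> S"
  obtains b c where "S = {a, b, c}" "distinct [a, b, c]"
proof -
  have "card (S - {a}) = 2" using assms by simp
  then obtain b c where "S - {a} = {b, c}" "b \<noteq> c" by (auto simp: card_2_iff)
  then have "S = {a, b, c}" "distinct [a, b, c]" using assms by auto
  then show ?thesis using that by blast
qed

context flat_graph begin

section \<open>No corner of a 4-cycle has degree 2\<close>

lemma nbrs_eq4:
  assumes "dg v \<le> 4" "distinct [a, b, c, d]" "{a, b, c, d} \<subseteq> N v"
  shows "N v = {a, b, c, d}"
  using card_seteq[OF N_finite assms(3)] assms(1,2) by simp

lemma nbrs_eq3:
  assumes "dg v \<le> 3" "distinct [a, b, c]" "{a, b, c} \<subseteq> N v"
  shows "N v = {a, b, c}"
  using card_seteq[OF N_finite assms(3)] assms(1,2) by simp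

lemma deg_ge4:
  assumes "distinct [a, b, c, d]" "{a, b, c, d} \<subseteq> N v"
  shows "dg v \<ge> 4"
  using card_mono[OF N_finite assms(2)] assms(1) by simp

lemma deg_ge3:
  assumes "distinct [a, b, c]" "{a, b, c} \<subseteq> N v"
  shows "dg v \<ge> 3"
  using card_mono[OF N_finite assms(2)] assms(1) by simp

text \<open>The outer neighbours of \<open>y\<close>, \<open>z\<close> and \<open>t\<close> all turn
  out to lead to the same two vertices \<open>w\<close>, \<open>w'\<close>, which are adjacent and
  of degree 4. Their edge is too heavy to be free, and it cannot lie on a 4-cycle either, because
  each of its ends has only degree-2 neighbours besides the other end.\<close>

lemma square_deg_ne2:
  assumes sq: "square E x y z t"
  shows "dg x \<noteq> 2"
proof
  assume x: "dg x = 2"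
  note s = square_edges[OF sq]
  note sqy = square_rot[OF sq] note sqz = square_rot[OF sqy] note sqt = square_rot[OF sqz]
  note sqr = square_reflect[OF sq]
  have y4: "dg y = 4" and t4: "dg t = 4" using square_2_deg_eq_4[OF sq x] square_2_deg_eq_4[OF sqr x] by auto
  obtain y2 y3 where Ny: "N y = {x, z, y2, y3}" "distinct [x, z, y2, y3]"
    using card_4_obtain_pair[OF y4 s(3,4,9)] by metis
  obtain t2 t3 where Nt: "N t = {x, z, t2, t3}" "distinct [x, z, t2, t3]"
    using card_4_obtain_pair[OF t4 s(8,7,9)] by metis
  have my: "y2 \<in> N y - {x, z}" "y3 \<in> N y - {x, z}" "y2 \<in> N y - {z, x}" "y3 \<in> N y - {z, x}" "y2 \<noteq> y3"
    using Ny by auto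
  have mt: "t2 \<in> N t - {x, z}" "t3 \<in> N t - {x, z}" "t2 \<noteq> t3" using Nt by auto
  obtain w where w: "N y2 = {y, w}" "w \<noteq> y" "w \<noteq> z" "w \<notin> N y" "dg y2 = 2"
    using outer_deg4[OF sqy y4 my(3)] by metis
  obtain w' where w': "N y3 = {y, w'}" "w' \<noteq> y" "w' \<noteq> z" "w' \<notin> N y" "dg y3 = 2"
    using outer_deg4[OF sqy y4 my(4)] by metis
  obtain v where v: "N t2 = {t, v}" "v \<noteq> t" "v \<noteq> z" "v \<notin> N t" "dg t2 = 2"
    using outer_deg4[OF sqt t4 mt(1)] by metis
  obtain v' where v': "N t3 = {t, v'}" "v' \<noteq> t" "v' \<noteq> z" "v' \<notin> N t" "dg t3 = 2"
    using outer_deg4[OF sqt t4 mt(2)] by metis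
  have cw: "common_nbr E w z" "common_nbr E w y3" using deg2_outer[OF sq x my(1,2,5) w(1,2)] by auto
  have cw': "common_nbr E w' z" using deg2_outer[OF sq x my(2,1) my(5)[symmetric] w'(1,2)] by auto
  have cv: "common_nbr E v z" using deg2_outer[OF sqr x mt(1,2,3) v(1,2)] by auto
  have cv': "common_nbr E v' z" using deg2_outer[OF sqr x mt(2,1) mt(3)[symmetric] v'(1,2)] by auto
  have ww': "w' \<in> N w" using common_nbr_deg2[OF w'(1) w(4)] cw(2) by simp
  have in_w: "y2 \<in> N w" "y3 \<in> N w'" "w \<in> N w'" using w(1) w'(1) ww' N_sym by blast+
  have wt: "w \<notin> N t" "w' \<notin> N t"
    using deg2_not_common_nbr[OF sq x my(1)] deg2_not_common_nbr[OF sq x my(2)] w(1) w'(1) by (auto simp: common_nbr_iff)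
  have vy: "v \<notin> N y" "v' \<notin> N y"
    using deg2_not_common_nbr[OF sqr x mt(1)] deg2_not_common_nbr[OF sqr x mt(2)] v(1) v'(1) by (auto simp: common_nbr_iff)
  obtain c where c: "c \<in> N w" "c \<in> N z" using cw(1) by (auto simp: common_nbr_iff)
  obtain c' where c': "c' \<in> N w'" "c' \<in> N z" using cw' by (auto simp: common_nbr_iff)
  have c_ne: "c \<noteq> y" "c \<noteq> t" using c(1) w(4) wt(1) N_sym by blast+
  have c'_ne: "c' \<noteq> y" "c' \<noteq> t" using c'(1) w'(4) wt(2) N_sym by blast+
  have cc': "c \<noteq> c'" using triangle_free[OF ww' c'(1)] c(1) by blast
  have dz: "distinct [y, t, c, c']" "{y, t, c, c'} \<subseteq> N z"
    using c_ne c'_ne cc' s(5,6,10) c(2) c'(2) by auto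
  have z4: "dg z = 4" using deg_ge4[OF dz] square_deg[OF sqz] by auto
  have Nz: "N z = {y, t, c, c'}" using nbrs_eq4[OF _ dz] z4 by simp
  have mc: "c \<in> N z - {t, y}" "c' \<in> N z - {t, y}" using c c' c_ne c'_ne by auto
  have other: "N a = {z, b} \<and> dg a = 2" if m: "a \<in> N z - {t, y}" "a \<in> N b" "b \<noteq> z" for a b
  proof -
    obtain b' where "N a = {z, b'}" "dg a = 2" using outer_deg4[OF sqz z4 m(1)] by metis
    moreover have "b \<in> N a" using m(2) N_sym by blast
    ultimately show ?thesis using m(3) by auto
  qed
  have Nc: "N c = {z, w}" "dg c = 2" using other[OF mc(1) c(1) w(3)] by auto
  have Nc': "N c' = {z, w'}" "dg c' = 2"
    using other[OF mc(2) c'(1) w'(3)] by auto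
  \<comment> \<open>\<open>z\<close> reaches outwards only through \<open>c\<close> and
    \<open>c'\<close>, so whatever shares such a neighbour with it is \<open>w\<close> or
    \<open>w'\<close>; this pins the far ends seen from \<open>t\<close>.\<close>
  have vw: "u \<in> {w, w'}" if u: "common_nbr E u z" "u \<notin> N t" "u \<notin> N y" "u \<noteq> z" for u
  proof -
    obtain d where d: "d \<in> N u" "d \<in> N z" using u(1) by (auto simp: common_nbr_iff)
    then have "u \<in> N d" using N_sym by simp
    moreover from this have "d \<noteq> y" "d \<noteq> t" using u(2,3) by auto
    then have "d \<in> {c, c'}" using d(2) Nz by simp
    ultimately show ?thesis using Nc(1) Nc'(1) u(4) by auto
  qed
  have "v \<noteq> v'"
    using outer_deg4_distinct[OF sqt mt(1,2,3), of v v'] v v' by simp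
  then have "{v, v'} = {w, w'}"
    using vw[OF cv v(4) vy(1) v(3)] vw[OF cv' v'(4) vy(2) v'(3)] by auto
  then obtain e e' where e: "N e = {t, w}" "N e' = {t, w'}" "dg e = 2" "dg e' = 2" "e \<in> N t" "e' \<in> N t"
    using v v' mt by (metis DiffD1 doubleton_eq_iff)
  have in_e: "e \<in> N w" "e' \<in> N w'" using e N_sym by blast+
  have yzt: "y \<noteq> z" "y \<noteq> t" "z \<noteq> t" using s(11) by auto
  have ne: "y2 \<noteq> c" "y2 \<noteq> e" "c \<noteq> e" "y3 \<noteq> c'" "y3 \<noteq> e'" "c' \<noteq> e'"
    using w(1,2,3) Nc(1) e(1) w'(1,2,3) Nc'(1) e(2) yzt by (metis doubleton_eq_iff)+
  have y_ne: "y \<noteq> y3" "z \<noteq> y3" "t \<noteq> y3" "y \<noteq> y2" "z \<noteq> y2" "t \<noteq> y2"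
    using y4 z4 t4 w(5) w'(5) by auto
  have w_ne: "w \<noteq> y3" "w' \<noteq> y2" using w(4) w'(4) my(1,2) by auto
  have "w' \<noteq> c" using in_w(2) Nc(1) y_ne(2) w_ne(1) by auto
  moreover have "w' \<noteq> e" using in_w(2) e(1) y_ne(3) w_ne(1) by auto
  moreover have "w \<noteq> c'" using in_w(1) Nc'(1) y_ne(5) w_ne(2) by auto
  moreover have "w \<noteq> e'" using in_w(1) e(2) y_ne(6) w_ne(2) by auto
  ultimately have ww_ne: "w' \<noteq> y2" "w' \<noteq> c" "w' \<noteq> e" "w \<noteq> y3" "w \<noteq> c'" "w \<noteq> e'"
    using w_ne by simp_all
  have dw: "distinct [y2, w', c, e]" "{y2, w', c, e} \<subseteq> N w"
    using ne(1-3) ww_ne(1-3) ww_ne(1-3)[symmetric] in_w(1) in_e(1) c(1) ww' by simp_all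
  have dw': "distinct [y3, w, c', e']" "{y3, w, c', e'} \<subseteq> N w'"
    using ne(4-6) ww_ne(4-6) ww_ne(4-6)[symmetric] in_w(2,3) in_e(2) c'(1) by simp_all
  have "\<not> free_edge w w'" using free_edge_deg[of w w'] deg_ge4[OF dw] deg_ge4[OF dw'] by auto
  then obtain a b where sqw: "square E w w' b a" using ww' unfolding free_edge_def by blast
  have Nw: "N w = {y2, w', c, e}" using nbrs_eq4[OF _ dw] square_deg[OF sqw] by auto
  have Nw': "N w' = {y3, w, c', e'}" using nbrs_eq4[OF _ dw'] square_deg[OF square_rot[OF sqw]] by auto
  note sw = square_edges[OF sqw]
  \<comment> \<open>As a neighbour of \<open>w\<close> the corner \<open>a\<close> has degree 2; as
    a neighbour of \<open>b\<close> it is one of \<open>y\<close>, \<open>z\<close>,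
    \<open>t\<close>, of degree 4.\<close>
  have "a \<in> {y2, c, e}" using sw(2,10) Nw by auto
  then have "dg a = 2" using w(5) Nc(2) e(3) by auto
  moreover have "b \<in> {y3, c', e'}" using sw(4,9) Nw' by auto
  then have "a \<in> {y, z, t}" using sw(6) sw(10) w'(1) Nc'(1) e(2) sw(7) by auto
  then have "dg a = 4" using y4 z4 t4 by auto
  ultimately show False by simp
qed

section \<open>Not all corners have degree 3\<close>

lemma deg3_outer:
  assumes sq: "square E x y z t" and x: "dg x = 3" and Nx: "N x = {y, t, u}" "distinct [y, t, u]"
  shows "free_edge x u" "dg u \<in> {2, 3}" "x \<in> N u"
proof -
  show "free_edge x u" using free_edge_square[OF sq, of u] Nx by auto
  from free_edge_deg[OF this] x show "dg u \<in> {2, 3}" by auto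
  show "x \<in> N u" using Nx N_sym by blast
qed

text \<open>A neighbour \<open>p\<close> of \<open>x'\<close> can share a neighbour with
  \<open>y\<close> or with \<open>t\<close> only through \<open>z\<close>, which forces
  \<open>p = z'\<close>; and \<open>z'\<close> does so with both. Degree 2 of \<open>x'\<close>
  demands exactly one of \<open>y\<close>, \<open>t\<close>, and degree 3 demands two different such
  vertices.\<close>

lemma not_all_deg3:
  assumes sq: "square E x y z t" and d: "dg x = 3" "dg y = 3" "dg z = 3" "dg t = 3"
  shows False
proof -
  note s = square_edges[OF sq]
  obtain x' where Nx: "N x = {y, t, x'}" "distinct [y, t, x']" using card_3_obtain_pair[OF d(1) s(1,2,10)] .
  obtain y' where Ny: "N y = {x, z, y'}" "distinct [x, z, y']" using card_3_obtain_pair[OF d(2) s(3,4,9)] .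
  obtain z' where Nz: "N z = {y, t, z'}" "distinct [y, t, z']" using card_3_obtain_pair[OF d(3) s(5,6,10)] .
  obtain t' where Nt: "N t = {x, z, t'}" "distinct [x, z, t']" using card_3_obtain_pair[OF d(4) s(8,7,9)] .
  have ncy: "\<not> common_nbr E x' y'" using square_3_3[OF sq Nx(1) Ny(1) Nx(2) Ny(2)] .
  have Nx2: "N x = {t, y, x'}" "distinct [t, y, x']" "N x = {x', y, t}" "distinct [x', y, t]" using Nx by auto
  have nct: "\<not> common_nbr E x' t'" using square_3_3[OF square_reflect[OF sq] Nx2(1) Nt(1) Nx2(2) Nt(2)] .
  note o = deg3_outer[OF sq d(1) Nx]
  have x'N: "x' \<in> N x" using Nx by auto
  have key: "p = z' \<longleftrightarrow> common_nbr E p y" "p = z' \<longleftrightarrow> common_nbr E p t" if p: "p \<in> N x'" "p \<noteq> x" for p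
  proof -
    have px: "p \<notin> N x" using triangle_free[OF x'N p(1)] .
    have "common_nbr E z' y" "common_nbr E z' t" using Nz s N_sym by (auto simp: common_nbr_iff)
    moreover have "p = z'" if r: "r \<in> N p" "r \<in> N y \<or> r \<in> N t" for r
    proof -
      have "r \<noteq> x" using r(1) px N_sym by blast
      moreover have "r \<noteq> y'" "r \<noteq> t'" using r(1) p(1) ncy nct N_sym[of p] by (auto simp: common_nbr_iff)
      ultimately have "r = z" using r(2) Ny Nt by auto
      then have "p \<in> N z" using r(1) N_sym by blast
      then show ?thesis using Nz px Nx by auto
    qed
    ultimately show "p = z' \<longleftrightarrow> common_nbr E p y" "p = z' \<longleftrightarrow> common_nbr E p t" by (auto simp: common_nbr_iff)
  qed
  consider "dg x' = 2" | "dg x' = 3" using o(2) by auto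
  then show False
  proof cases
    case 1
    obtain p where p: "N x' = {x, p}" "p \<noteq> x" using card_2_obtain[OF 1 o(3)] .
    show False using free_edge_2_3[OF free_edge_sym[OF o(1)] p(1) Nx2(3) p(2) Nx2(4)] key[of p] p by auto
  next
    case 2
    obtain p q where pq: "N x' = {x, p, q}" "distinct [x, p, q]" using card_3_obtain_member[OF 2 o(3)] .
    then have qp: "N x' = {x, q, p}" "distinct [x, q, p]" by auto
    have "common_nbr E p y \<or> common_nbr E p t" using free_edge_3_3[OF free_edge_sym[OF o(1)] pq(1) Nx2(3) pq(2) Nx2(4)] .
    moreover have "common_nbr E q y \<or> common_nbr E q t" using free_edge_3_3[OF free_edge_sym[OF o(1)] qp(1) Nx2(3) qp(2) Nx2(4)] .
    ultimately show False using key[of p] key[of q] pq by auto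
  qed
qed

section \<open>Two adjacent corners of degree 4\<close>

lemma deg2_free_edge:
  assumes "dg v = 2" "u \<in> N v"
  shows "free_edge v u"
  using assms square_deg_ne2 unfolding free_edge_def by blast

text \<open>Outer neighbours here have degree 2, so the common neighbours given by
  \<open>square_4_4\<close> must be their far ends. The hubs \<open>p\<close>, \<open>q\<close> are
  inputs, so that the lemma can be iterated around the cycle with the names kept.\<close>

lemma adjacent_deg4_hubs:
  assumes sq: "square E x y z t" and x4: "dg x = 4" and y4: "dg y = 4"
    and Nx: "N x = {y, t, x2, x3}" "distinct [y, t, x2, x3]"
    and Nx2: "N x2 = {x, p}" and Nx3: "N x3 = {x, q}"
  obtains y2 y3 where "N y = {x, z, y2, y3}" "distinct [x, z, y2, y3]"
    "N y2 = {y, p}" "N y3 = {y, q}" "p \<noteq> q" "p \<notin> N x" "q \<notin> N x" "p \<notin> N y" "q \<notin> N y"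
proof -
  note s = square_edges[OF sq]
  note sqy = square_rot[OF sq]
  have mx: "x2 \<in> N x - {y, t}" "x3 \<in> N x - {y, t}" "x2 \<noteq> x3" using Nx by auto
  have p: "p \<notin> N x" "p \<noteq> x"
  proof -
    obtain w where "N x2 = {x, w}" "w \<noteq> x" "w \<notin> N x" using outer_deg4[OF sq x4 mx(1)] by metis
    then show "p \<notin> N x" "p \<noteq> x" using Nx2 by (auto simp: doubleton_eq_iff)
  qed
  have q: "q \<notin> N x" "q \<noteq> x"
  proof -
    obtain w where "N x3 = {x, w}" "w \<noteq> x" "w \<notin> N x" using outer_deg4[OF sq x4 mx(2)] by metis
    then show "q \<notin> N x" "q \<noteq> x" using Nx3 by (auto simp: doubleton_eq_iff)
  qed
  have pq: "p \<noteq> q" using outer_deg4_distinct[OF sq mx, of p q] p Nx2 Nx3 by auto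
  obtain y2 y3 where Ny: "N y = {x, z, y2, y3}" "distinct [x, z, y2, y3]"
    using card_4_obtain_pair[OF y4 s(3,4,9)] by metis
  have my: "y2 \<in> N y - {z, x}" "y3 \<in> N y - {z, x}" "y2 \<noteq> y3" using Ny by auto
  obtain r where r: "N y2 = {y, r}" "r \<noteq> y" "r \<notin> N y" using outer_deg4[OF sqy y4 my(1)] by metis
  obtain r' where r': "N y3 = {y, r'}" "r' \<noteq> y" "r' \<notin> N y" using outer_deg4[OF sqy y4 my(2)] by metis
  have rr': "r \<noteq> r'" using outer_deg4_distinct[OF sqy my, of r r'] r r' by auto
  have ne: "x \<noteq> y" "r \<noteq> x" "r' \<noteq> x" "p \<noteq> y" "q \<noteq> y" using r(3) r'(3) p(1) q(1) s(1,3) N_irrefl[of x] by auto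
  have Nx': "N x = {y, t, x3, x2}" "distinct [y, t, x3, x2]" using Nx by auto
  have "p = r \<or> p = r'"
    using square_4_4[OF sq Nx(1) Ny(1) Nx(2) Ny(2)] Nx2 r(1) r'(1) ne by (auto simp: common_nbr_def)
  moreover have "q = r \<or> q = r'"
    using square_4_4[OF sq Nx'(1) Ny(1) Nx'(2) Ny(2)] Nx3 r(1) r'(1) ne by (auto simp: common_nbr_def)
  ultimately consider "p = r" "q = r'" | "p = r'" "q = r" using pq by auto
  then show ?thesis
  proof cases
    case 1
    then show ?thesis using that[OF Ny] r r' pq p q by simp
  next
    case 2
    have "N y = {x, z, y3, y2}" "distinct [x, z, y3, y2]" using Ny by auto
    from that[OF this] show ?thesis using 2 r r' pq p q by simp
  qed
qed

text \<open>Far ends outside \<open>N t\<close> leave \<open>t\<close> without common neighbours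
  with \<open>v\<close> and \<open>w\<close>, so \<open>square_3_4\<close> applies to each of them;
  their only possible link to \<open>u\<close> is the far end.\<close>

lemma outer_common:
  assumes sq: "square E x y z t"
    and Nx: "N x = {y, t, u}" "distinct [y, t, u]" and Ny: "N y = {x, z, v, w}" "distinct [x, z, v, w]"
    and Nv: "N v = {y, v'}" and Nw: "N w = {y, w'}" and "v' \<notin> N t" "w' \<notin> N t"
  shows "v' \<in> N u" "w' \<in> N u"
proof -
  note s = square_edges[OF sq]
  have "u \<in> N x" using Nx by simp
  then have y: "t \<notin> N y" "u \<notin> N y"
    using triangle_free[OF s(3), of t] triangle_free[OF s(3), of u] s(2) by auto
  have t: "\<not> common_nbr E t v" "\<not> common_nbr E t w"
    using common_nbr_deg2[OF Nv y(1)] common_nbr_deg2[OF Nw y(1)] assms by auto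
  have Ny': "N y = {x, z, w, v}" "distinct [x, z, w, v]" using Ny by auto
  have "common_nbr E u v" "common_nbr E u w"
    using square_3_4[OF sq Nx(1) Ny(1) Nx(2) Ny(2) t] square_3_4[OF sq Nx(1) Ny'(1) Nx(2) Ny'(2) t(2,1)] by auto
  then show "v' \<in> N u" "w' \<in> N u"
    using common_nbr_deg2[OF Nv y(2)] common_nbr_deg2[OF Nw y(2)] by auto
qed

text \<open>\<open>p\<close> meets \<open>x2\<close>, \<open>y2\<close>, \<open>t2\<close> and the
  common neighbour \<open>r\<close> with \<open>z\<close>, so the edge from \<open>t2\<close>
  (degree 3) to \<open>p\<close> is not free. Its 4-cycle can only be \<open>t2\<close>,
  \<open>p\<close>, \<open>r\<close>, \<open>q\<close>; this gives \<open>r\<close> degree at least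
  3 and \<open>z\<close> degree 3. Then \<open>p\<close> is shared by \<open>t2\<close> and
  \<open>r\<close>, against \<open>square_3_3\<close> on the edge \<open>t z\<close>.\<close>

lemma no_4_4_3_aux:
  assumes sq: "square E x y z t"
    and Nx2: "N x2 = {x, p}" and Ny2: "N y2 = {y, p}"
    and p: "p \<notin> N x" "p \<notin> N y" and q: "q \<notin> N x" "q \<notin> N y" and pq: "p \<noteq> q"
    and Nt: "N t = {x, z, t2}" "distinct [x, z, t2]"
    and Nt2: "N t2 = {t, p, q}" "distinct [t, p, q]" and common_nbr: "common_nbr E z p"
  shows False
proof -
  note s = square_edges[OF sq]
  have t3: "dg t = 3" "dg t2 = 3" using Nt Nt2 by auto
  have o: "free_edge t t2" using free_edge_square[OF square_rot[OF square_rot[OF square_rot[OF sq]]], of t2] Nt by auto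
  have ne: "p \<noteq> x" "p \<noteq> y" "p \<noteq> z" "q \<noteq> x" "q \<noteq> y" "q \<noteq> z" using p q s(1,3,4) by auto
  obtain r where r: "r \<in> N z" "r \<in> N p" using common_nbr by (auto simp: common_nbr_iff)
  then have zr: "z \<in> N r" "p \<in> N r" using N_sym by auto
  have "y \<noteq> z" "x \<noteq> y" "z \<noteq> t" using s(11) by auto
  then have "z \<notin> N x2" "z \<notin> N y2" "z \<notin> N t2" unfolding Nx2 Ny2 Nt2(1) using s(9) ne by auto
  then have "r \<noteq> x2" "r \<noteq> y2" "r \<noteq> t2" using zr(1) by auto
  moreover have "x \<notin> N y2" "x \<in> N x2" unfolding Nx2 Ny2 using \<open>x \<noteq> y\<close> ne by auto
  then have "x2 \<noteq> y2" by auto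
  moreover have "dg x2 \<le> 2" "dg y2 \<le> 2" unfolding Nx2 Ny2 by (simp_all add: card_insert_if)
  then have "x2 \<noteq> t2" "y2 \<noteq> t2" using t3(2) by auto
  moreover have "x2 \<in> N p" "y2 \<in> N p" "t2 \<in> N p" 
    using Nx2 Ny2 Nt2(1) N_sym[of p x2] N_sym[of p y2] N_sym[of p t2] by simp_all
  ultimately have dp: "distinct [x2, y2, t2, r]" "{x2, y2, t2, r} \<subseteq> N p" using r by auto
  have "\<not> free_edge t2 p" using free_edge_deg[of t2 p] deg_ge4[OF dp] t3 by auto
  moreover have "p \<in> N t2" using Nt2 by simp
  ultimately obtain a b where sqp: "square E t2 p b a" unfolding free_edge_def by blast
  note sp = square_edges[OF sqp]
  have Np: "N p = {x2, y2, t2, r}" using nbrs_eq4[OF _ dp] square_deg[OF square_rot[OF sqp]] by auto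
  have "a \<noteq> t"
  proof
    assume "a = t"
    with sqp have "square E t t2 p b" using square_rot by blast
    with o show False unfolding free_edge_def by blast
  qed
  then have "a = q" using sp(2,10) Nt2 by auto
  then have bq: "q \<in> N b" using sp(6) by simp
  have "b \<noteq> x2" using bq Nx2 ne pq by auto
  moreover have "b \<noteq> y2" using bq Ny2 ne pq by auto
  ultimately have "b = r" using sp(4,9) Np by auto
  with bq zr ne pq have r3: "dg r \<ge> 3" using deg_ge3[of p q z r] by auto
  have "r \<noteq> y" using r(2) p(2) N_sym by blast
  moreover have "r \<noteq> t"
  proof
    assume "r = t"
    then have "p = x \<or> p = z \<or> p = t2" using zr(2) Nt by auto
    then show False using ne \<open>p \<in> N t2\<close> N_irrefl by auto
  qed
  ultimately have dz: "distinct [y, t, r]" "{y, t, r} \<subseteq> N z" using s(5,6,10) r by auto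
  have "free_edge z r" using free_edge_square[OF square_rot[OF square_rot[OF sq]], of r] r \<open>r \<noteq> y\<close> \<open>r \<noteq> t\<close> by auto
  from free_edge_deg[OF this] r3 have "dg z \<le> 3" by auto
  then have Nz: "N z = {t, y, r}" "distinct [t, y, r]" using nbrs_eq3[OF _ dz] dz by auto
  have "square E t z y x" using square_reflect[OF square_rot[OF square_rot[OF square_rot[OF sq]]]] .
  moreover have "N t = {z, x, t2}" "distinct [z, x, t2]" using Nt by auto
  ultimately have "\<not> common_nbr E t2 r" using square_3_3 Nz by blast
  then show False using \<open>p \<in> N t2\<close> zr by (auto simp: common_nbr_iff)
qed

lemma no_4_4_3:
  assumes sq: "square E x y z t" and x4: "dg x = 4" and y4: "dg y = 4"
  shows "dg t \<noteq> 3"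
proof
  assume t3: "dg t = 3"
  note s = square_edges[OF sq]
  note sqy = square_rot[OF sq] note sqz = square_rot[OF sqy] note sqt = square_rot[OF sqz]
  obtain x2 x3 where Nx: "N x = {y, t, x2, x3}" "distinct [y, t, x2, x3]"
    using card_4_obtain_pair[OF x4 s(1,2,10)] by metis
  have mx: "x2 \<in> N x - {y, t}" "x3 \<in> N x - {y, t}" "x2 \<noteq> x3" using Nx by auto
  obtain p where Nx2: "N x2 = {x, p}" using outer_deg4[OF sq x4 mx(1)] by metis
  obtain q where Nx3: "N x3 = {x, q}" using outer_deg4[OF sq x4 mx(2)] by metis
  obtain y2 y3 where Ny: "N y = {x, z, y2, y3}" "distinct [x, z, y2, y3]"
    and Ny2: "N y2 = {y, p}" and Ny3: "N y3 = {y, q}" and pq: "p \<noteq> q"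
    and p: "p \<notin> N x" "p \<notin> N y" and q: "q \<notin> N x" "q \<notin> N y"
    using adjacent_deg4_hubs[OF sq x4 y4 Nx Nx2 Nx3] by metis
  \<comment> \<open>Otherwise \<open>y\<close>, \<open>v\<close>, \<open>r\<close>, \<open>z\<close>
    would be a second 4-cycle at \<open>y\<close>.\<close>
  have hub: "r \<notin> N z" if "N v = {y, r}" "v \<in> N y" "v \<noteq> x" "v \<noteq> z" "r \<notin> N x" for v r
  proof
    assume "r \<in> N z"
    moreover have "r \<noteq> y" using that(5) s(1) by auto
    ultimately have "square E y v r z" using that s(4,5) N_sym[of z r] by (auto simp: square_def)
    from square_unique(2)[OF sqy this] that show False by (auto simp: doubleton_eq_iff)
  qed
  have pz: "p \<notin> N z" "q \<notin> N z" using hub[OF Ny2 _ _ _ p(1)] hub[OF Ny3 _ _ _ q(1)] Ny by auto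
  obtain t2 where Nt: "N t = {x, z, t2}" "distinct [x, z, t2]" using card_3_obtain_pair[OF t3 s(8,7,9)] .
  have Nx': "N x = {t, y, x2, x3}" "distinct [t, y, x2, x3]" using Nx by auto
  have t2: "p \<in> N t2" "q \<in> N t2" using outer_common[OF sqt Nt Nx' Nx2 Nx3 pz] N_sym by auto
  have o: "free_edge t t2" using free_edge_square[OF sqt, of t2] Nt by auto
  from free_edge_deg[OF this] t3 have "dg t2 \<le> 3" by auto
  moreover have "t \<in> N t2" using Nt N_sym by blast
  moreover have "p \<noteq> t" "q \<noteq> t" using p(1) q(1) s(2) by auto
  ultimately have Nt2: "N t2 = {t, p, q}" "distinct [t, p, q]" using nbrs_eq3[of t2 t p q] t2 pq by auto
  then have Nt2': "N t2 = {t, q, p}" "distinct [t, q, p]" by auto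
  have Nt': "N t = {t2, z, x}" "distinct [t2, z, x]" using Nt by auto
  \<comment> \<open>For the free edge \<open>t t2\<close> the corner \<open>z\<close> is itself an
    outer neighbour of \<open>t\<close>.\<close>
  have "common_nbr E z p \<or> common_nbr E z q" using free_edge_3_3[OF o Nt'(1) Nt2(1) Nt'(2) Nt2(2)] .
  then show False
    using no_4_4_3_aux[OF sq Nx2 Ny2 p q pq Nt Nt2] no_4_4_3_aux[OF sq Nx3 Ny3 q p pq[symmetric] Nt Nt2'] by blast
qed

end

section \<open>Recognizing the two graphs\<close>

text \<open>Follows the vertex list in \<open>R1_iso\<close>: corners 0 to 3, middle vertices 4 to
  11 as the index is 1 or 2, hubs 12 and 13. Distinctness of that list thus becomes
  injectivity.\<close>

fun R1_index :: "R1_vertex \<Rightarrow> nat" where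
  "R1_index (Corner c) = (case c of Ca \<Rightarrow> 0 | Cb \<Rightarrow> 1 | Cc \<Rightarrow> 2 | Cd \<Rightarrow> 3)"
| "R1_index (Mid c i) = 4 * i + (case c of Ca \<Rightarrow> 0 | Cb \<Rightarrow> 1 | Cc \<Rightarrow> 2 | Cd \<Rightarrow> 3)"
| "R1_index (Hub i) = 11 + i"

lemma R1_verts_eq:
  "R1_verts = {Corner Ca, Corner Cb, Corner Cc, Corner Cd,
    Mid Ca 1, Mid Cb 1, Mid Cc 1, Mid Cd 1, Mid Ca 2, Mid Cb 2, Mid Cc 2, Mid Cd 2, Hub 1, Hub 2}"
proof -
  have "(UNIV :: corner set) = {Ca, Cb, Cc, Cd}" using corner.exhaust by auto
  moreover have "R1_verts = Corner ` UNIV \<union> case_prod Mid ` (UNIV \<times> {1, 2}) \<union> Hub ` {1, 2}"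
    by (auto simp: R1_verts_def)
  ultimately show ?thesis by auto
qed

lemma R1_nbrs:
  "nbrs R1_edges (Corner Ca) = {Corner Cb, Corner Cd, Mid Ca 1, Mid Ca 2}"
  "nbrs R1_edges (Corner Cb) = {Corner Ca, Corner Cc, Mid Cb 1, Mid Cb 2}"
  "nbrs R1_edges (Corner Cc) = {Corner Cb, Corner Cd, Mid Cc 1, Mid Cc 2}"
  "nbrs R1_edges (Corner Cd) = {Corner Ca, Corner Cc, Mid Cd 1, Mid Cd 2}"
  by (auto simp: nbrs_def R1_edges_def doubleton_eq_iff)

lemma R1_nbrs_mid: "i \<in> {1, 2} \<Longrightarrow> nbrs R1_edges (Mid c i) = {Corner c, Hub i}"
  by (auto simp: nbrs_def R1_edges_def doubleton_eq_iff)

lemma R1_nbrs_hub: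
  assumes "i \<in> {1, 2}"
  shows "nbrs R1_edges (Hub i) = {Mid Ca i, Mid Cb i, Mid Cc i, Mid Cd i}"
proof -
  have "nbrs R1_edges (Hub i) = range (\<lambda>c. Mid c i)"
    using assms by (auto simp: nbrs_def R1_edges_def doubleton_eq_iff)
  also have "\<dots> = (\<lambda>c. Mid c i) ` {Ca, Cb, Cc, Cd}"
    using corner.exhaust by (intro arg_cong[where f = "image _"]) auto
  finally show ?thesis by simp
qed

lemma R2_verts_eq: "R2_verts = {0, 1, 2, 3, 4, 5, 6, 7, 8, 9, 10, 11}"
proof (rule set_eqI)
  fix i show "i \<in> R2_verts \<longleftrightarrow> i \<in> {0, 1, 2, 3, 4, 5, 6, 7, 8, 9, 10, 11}"
    unfolding R2_verts_def atLeastAtMost_iff insert_iff empty_iff by presburger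
qed

lemma R2_nbrs:
  "nbrs R2_edges 0 = {1, 3, 8, 9}" "nbrs R2_edges 1 = {0, 2, 7}" "nbrs R2_edges 2 = {1, 3, 10, 11}"
  "nbrs R2_edges 3 = {0, 2, 4}" "nbrs R2_edges 4 = {3, 5, 6}" "nbrs R2_edges 5 = {4, 7, 9, 11}"
  "nbrs R2_edges 6 = {4, 7, 8, 10}" "nbrs R2_edges 7 = {1, 5, 6}" "nbrs R2_edges 8 = {0, 6}"
  "nbrs R2_edges 9 = {0, 5}" "nbrs R2_edges 10 = {2, 6}" "nbrs R2_edges 11 = {2, 5}"
  by (auto simp: nbrs_def R2_edges_def doubleton_eq_iff)

context flat_graph begin

lemma R1_iso:
  assumes d: "distinct [x, y, z, t, x1, y1, z1, t1, x2, y2, z2, t2, p, q]"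
    and N: "N x = {y, t, x1, x2}" "N y = {x, z, y1, y2}" "N z = {y, t, z1, z2}" "N t = {x, z, t1, t2}"
      "N x1 = {x, p}" "N y1 = {y, p}" "N z1 = {z, p}" "N t1 = {t, p}"
      "N x2 = {x, q}" "N y2 = {y, q}" "N z2 = {z, q}" "N t2 = {t, q}"
      "N p = {x1, y1, z1, t1}" "N q = {x2, y2, z2, t2}"
  shows "graph_iso V E R1_verts R1_edges"
proof (rule graph_isoI)
  define l where "l = [x, y, z, t, x1, y1, z1, t1, x2, y2, z2, t2, p, q]"
  have l: "l ! 0 = x" "l ! 1 = y" "l ! 2 = z" "l ! 3 = t" "l ! 4 = x1" "l ! 5 = y1" "l ! 6 = z1" "l ! 7 = t1"
    "l ! 8 = x2" "l ! 9 = y2" "l ! 10 = z2" "l ! 11 = t2" "l ! 12 = p" "l ! 13 = q" "length l = 14"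
    by (simp_all add: l_def)
  define g where "g = nth l \<circ> R1_index"
  have "inj_on R1_index R1_verts" by (simp add: R1_verts_eq)
  moreover have "inj_on (nth l) (R1_index ` R1_verts)"
    by (rule inj_on_nth) (use d in \<open>simp_all add: l(15) R1_verts_eq\<close>, simp add: l_def)
  ultimately show "inj_on g R1_verts"
    unfolding g_def by (rule comp_inj_on)
  show "R1_verts \<noteq> {}" by (simp add: R1_verts_eq)
  have g: "g (Corner Ca) = x" "g (Corner Cb) = y" "g (Corner Cc) = z" "g (Corner Cd) = t"
    "g (Mid Ca 1) = x1" "g (Mid Cb 1) = y1" "g (Mid Cc 1) = z1" "g (Mid Cd 1) = t1"
    "g (Mid Ca 2) = x2" "g (Mid Cb 2) = y2" "g (Mid Cc 2) = z2" "g (Mid Cd 2) = t2" "g (Hub 1) = p" "g (Hub 2) = q"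
    by (simp_all add: g_def l(1-14) l(2)[simplified])
  fix i assume "i \<in> R1_verts"
  then consider "i = Corner Ca" | "i = Corner Cb" | "i = Corner Cc" | "i = Corner Cd"
    | "i = Mid Ca 1" | "i = Mid Cb 1" | "i = Mid Cc 1" | "i = Mid Cd 1"
    | "i = Mid Ca 2" | "i = Mid Cb 2" | "i = Mid Cc 2" | "i = Mid Cd 2" | "i = Hub 1" | "i = Hub 2"
    unfolding R1_verts_eq by blast
  then have "N (g i) = g ` nbrs R1_edges i \<and> nbrs R1_edges i \<subseteq> R1_verts \<and> nbrs R1_edges i \<noteq> {}"
    by cases (simp_all only: R1_nbrs R1_nbrs_mid R1_nbrs_hub insertI1 insertI2 singletonI image_insert image_empty g N,
        simp_all add: R1_verts_eq)
  then show "N (g i) = g ` nbrs R1_edges i" "nbrs R1_edges i \<subseteq> R1_verts" "nbrs R1_edges i \<noteq> {}"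
    by auto
qed

text \<open>The list \<open>d\<close> is in the order of the numbers 0 to 11: the known 4-cycle is
  \<open>y\<close>, \<open>x\<close>, \<open>t\<close>, \<open>z\<close>, the second one
  \<open>z'\<close>, \<open>w'\<close>, \<open>x'\<close>, \<open>w\<close> (numbers 4, 5, 7,
  6).\<close>

lemma R2_iso:
  assumes d: "distinct [y, x, t, z, z', w', w, x', y1, y2, t1, t2]"
    and N: "N y = {x, z, y1, y2}" "N x = {y, t, x'}" "N t = {x, z, t1, t2}" "N z = {y, t, z'}"
      "N z' = {z, w', w}" "N w' = {z', x', y2, t2}" "N w = {z', x', y1, t1}" "N x' = {x, w', w}"
      "N y1 = {y, w}" "N y2 = {y, w'}" "N t1 = {t, w}" "N t2 = {t, w'}"
  shows "graph_iso V E R2_verts R2_edges"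
proof (rule graph_isoI)
  define g where "g = nth [y, x, t, z, z', w', w, x', y1, y2, t1, t2]"
  show "inj_on g R2_verts"
    unfolding g_def by (rule inj_on_nth[OF d]) (auto simp: R2_verts_def)
  show "R2_verts \<noteq> {}" by (simp add: R2_verts_eq)
  have g: "g 0 = y" "g 1 = x" "g 2 = t" "g 3 = z" "g 4 = z'" "g 5 = w'" "g 6 = w" "g 7 = x'"
    "g 8 = y1" "g 9 = y2" "g 10 = t1" "g 11 = t2"
    by (simp_all add: g_def)
  fix i assume "i \<in> R2_verts"
  then consider "i = 0" | "i = 1" | "i = 2" | "i = 3" | "i = 4" | "i = 5" | "i = 6" | "i = 7"
    | "i = 8" | "i = 9" | "i = 10" | "i = 11"
    unfolding R2_verts_eq by blast
  then have "N (g i) = g ` nbrs R2_edges i \<and> nbrs R2_edges i \<subseteq> R2_verts \<and> nbrs R2_edges i \<noteq> {}"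
    by cases (simp_all only: R2_nbrs image_insert image_empty g N, simp_all add: R2_verts_eq)
  then show "N (g i) = g ` nbrs R2_edges i" "nbrs R2_edges i \<subseteq> R2_verts" "nbrs R2_edges i \<noteq> {}"
    by auto
qed

section \<open>Reconstructing the graph from the degrees on one 4-cycle\<close>

lemma disjoint_by_degree:
  assumes "\<And>u. u \<in> A \<Longrightarrow> dg u = m" "\<And>u. u \<in> B \<Longrightarrow> dg u = n" "m \<noteq> n"
  shows "A \<inter> B = {}"
  using assms by blast

lemma square_all_deg4:
  assumes sq: "square E x y z t" and d: "dg x = 4" "dg y = 4" "dg z = 4" "dg t = 4"
  shows "graph_iso V E R1_verts R1_edges"
proof -
  note s = square_edges[OF sq]
  note sqy = square_rot[OF sq] note sqz = square_rot[OF sqy] note sqt = square_rot[OF sqz]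
  obtain x1 x2 where Nx: "N x = {y, t, x1, x2}" "distinct [y, t, x1, x2]"
    using card_4_obtain_pair[OF d(1) s(1,2,10)] by metis
  have mx: "x1 \<in> N x - {y, t}" "x2 \<in> N x - {y, t}" using Nx by auto
  obtain p where x1: "N x1 = {x, p}" using outer_deg4[OF sq d(1) mx(1)] by metis
  obtain q where x2: "N x2 = {x, q}" using outer_deg4[OF sq d(1) mx(2)] by metis
  obtain y1 y2 where Ny: "N y = {x, z, y1, y2}" "distinct [x, z, y1, y2]"
    and y12: "N y1 = {y, p}" "N y2 = {y, q}" and pq: "p \<noteq> q"
    and pqx: "p \<notin> N x" "q \<notin> N x" and pqy: "p \<notin> N y" "q \<notin> N y"
    using adjacent_deg4_hubs[OF sq d(1,2) Nx x1 x2] by metis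
  have Ny': "N y = {z, x, y1, y2}" "distinct [z, x, y1, y2]" using Ny by auto
  obtain z1 z2 where Nz: "N z = {y, t, z1, z2}" "distinct [y, t, z1, z2]"
    and z12: "N z1 = {z, p}" "N z2 = {z, q}"
    using adjacent_deg4_hubs[OF sqy d(2,3) Ny' y12] by metis
  have Nz': "N z = {t, y, z1, z2}" "distinct [t, y, z1, z2]" using Nz by auto
  obtain t1 t2 where Nt: "N t = {z, x, t1, t2}" "distinct [z, x, t1, t2]"
    and t12: "N t1 = {t, p}" "N t2 = {t, q}"
    using adjacent_deg4_hubs[OF sqz d(3,4) Nz' z12] by metis
  have Nt': "N t = {x, z, t1, t2}" using Nt by auto
  have pne: "p \<notin> {x, y, z, t}" using pqx pqy s(1-4) by auto
  have qne: "q \<notin> {x, y, z, t}" using pqx pqy s(1-4) by auto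
  \<comment> \<open>Different neighbourhoods separate the eight middle vertices; the remaining
    coincidences are excluded by degree.\<close>
  have "distinct (map N [x1, y1, z1, t1, x2, y2, z2, t2])"
    using s(11) pne qne pq by (simp add: x1 x2 y12 z12 t12 doubleton_eq_iff)
  then have dm: "distinct [x1, y1, z1, t1, x2, y2, z2, t2]" by (rule distinct_map[THEN iffD1, THEN conjunct1])
  have deg2: "dg u = 2" if "u \<in> {x1, y1, z1, t1, x2, y2, z2, t2}" for u
    using that pne qne by (auto simp: x1 x2 y12 z12 t12)
  \<comment> \<open>A neighbour of degree 2 makes the edge free and caps the degree of
    \<open>h\<close> at 4, so four known neighbours are all of them.\<close>
  have hub: "N h = {a, b, c, e}" if "a \<in> N h" "b \<in> N h" "c \<in> N h" "e \<in> N h" "distinct [a, b, c, e]" "dg a = 2" for a b c e h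
  proof -
    have "free_edge a h" using deg2_free_edge that(1,6) N_sym by blast
    from free_edge_deg[OF this] have "dg h \<le> 4" by auto
    then show ?thesis using that by (intro nbrs_eq4) auto
  qed
  have "x1 \<in> N p" "y1 \<in> N p" "z1 \<in> N p" "t1 \<in> N p" "x2 \<in> N q" "y2 \<in> N q" "z2 \<in> N q" "t2 \<in> N q"
    using x1 x2 y12 z12 t12 N_sym[of _ p] N_sym[of _ q] by auto
  moreover have "distinct [x1, y1, z1, t1]" "distinct [x2, y2, z2, t2]" "dg x1 = 2" "dg x2 = 2"
    using dm deg2 by auto
  ultimately have Np: "N p = {x1, y1, z1, t1}" and Nq: "N q = {x2, y2, z2, t2}"
    using hub by blast+
  have deg4: "dg u = 4" if "u \<in> {x, y, z, t, p, q}" for u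
    using that d dm by (auto simp: Np Nq)
  have "{x, y, z, t, p, q} \<inter> {x1, y1, z1, t1, x2, y2, z2, t2} = {}"
    by (rule disjoint_by_degree[OF deg4 deg2]) simp_all
  moreover have "distinct [x, y, z, t, p, q]" using s(11) pne qne pq by auto
  ultimately have "distinct [x, y, z, t, x1, y1, z1, t1, x2, y2, z2, t2, p, q]" using dm by auto
  then show ?thesis
    by (rule R1_iso) (fact Nx Ny Nz Nt' x1 x2 y12 z12 t12 Np Nq)+
qed

text \<open>If \<open>w\<close> were adjacent to \<open>t\<close> of degree 4, it would have degree
  2. The free edge \<open>v w\<close> would then have both degrees 2 while its outer vertices
  \<open>y\<close> and \<open>t\<close> share \<open>x\<close>, against
  \<open>free_edge_2_2\<close>.\<close>

lemma outer_deg4_opposite: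
  assumes sq: "square E x y z t" and y4: "dg y = 4" and v: "v \<in> N y - {z, x}" and Nv: "N v = {y, w}"
  shows "w \<noteq> y" "w \<notin> N y" "dg v = 2" "dg t = 4 \<Longrightarrow> w \<notin> N t"
proof -
  note s = square_edges[OF sq]
  obtain w' where w': "N v = {y, w'}" "w' \<noteq> y" "w' \<notin> N y" "dg v = 2"
    using outer_deg4[OF square_rot[OF sq] y4 v] by metis
  with Nv have ww: "w' = w" by (auto simp: doubleton_eq_iff)
  with w' show w: "w \<noteq> y" "w \<notin> N y" and v2: "dg v = 2" by auto
  assume t4: "dg t = 4"
  show "w \<notin> N t"
  proof
    assume wt: "w \<in> N t"
    have "w \<noteq> x" "w \<noteq> z" using w(2) s(3,4) by auto
    then have "free_edge t w" using free_edge_square[OF square_rot[OF square_rot[OF square_rot[OF sq]]], of w] wt by auto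
    from free_edge_deg[OF this] t4 have w2: "dg w = 2" by auto
    have "t \<notin> N y" using triangle_free[OF s(3), of t] s(2) by auto
    then have "v \<noteq> t" using v by auto
    have "v \<in> N w" "t \<in> N w" using Nv wt N_sym[of v w] N_sym[of t w] by auto
    obtain t' where "N w = {v, t'}" "t' \<noteq> v" using card_2_obtain[OF w2 \<open>v \<in> N w\<close>] .
    with \<open>t \<in> N w\<close> \<open>v \<noteq> t\<close> have Nw: "N w = {v, t}" by auto
    have "w \<in> N v" using Nv by simp
    have Nv': "N v = {w, y}" using Nv by auto
    have "\<not> common_nbr E y t"
      using free_edge_2_2[OF deg2_free_edge[OF v2 \<open>w \<in> N v\<close>] Nv' Nw] w(1) \<open>v \<noteq> t\<close> by auto
    then show False using s(3,8) by (auto simp: common_nbr_iff)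
  qed
qed

text \<open>The far ends \<open>w\<close>, \<open>w'\<close> seen from \<open>y\<close> are adjacent
  to both \<open>x'\<close> and \<open>z'\<close>, which yields the second 4-cycle
  \<open>x'\<close>, \<open>w\<close>, \<open>z'\<close>, \<open>w'\<close>.\<close>

lemma square_3434:
  assumes sq: "square E x y z t" and d: "dg x = 3" "dg y = 4" "dg z = 3" "dg t = 4"
  shows "graph_iso V E R2_verts R2_edges"
proof -
  note s = square_edges[OF sq]
  note sqy = square_rot[OF sq] note sqz = square_rot[OF sqy] note sqt = square_rot[OF sqz]
  note sqxr = square_reflect[OF sq] note sqzr = square_reflect[OF sqz] note sqtr = square_reflect[OF sqt]
  obtain x' where Nx: "N x = {y, t, x'}" "distinct [y, t, x']" using card_3_obtain_pair[OF d(1) s(1,2,10)] .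
  obtain z' where Nz: "N z = {y, t, z'}" "distinct [y, t, z']" using card_3_obtain_pair[OF d(3) s(5,6,10)] .
  obtain y1 y2 where Ny: "N y = {x, z, y1, y2}" "distinct [x, z, y1, y2]"
    using card_4_obtain_pair[OF d(2) s(3,4,9)] by metis
  have my: "y1 \<in> N y - {z, x}" "y2 \<in> N y - {z, x}" "y1 \<noteq> y2" using Ny by auto
  obtain w where y1: "N y1 = {y, w}" using outer_deg4[OF sqy d(2) my(1)] by metis
  obtain w' where y2: "N y2 = {y, w'}" using outer_deg4[OF sqy d(2) my(2)] by metis
  note o1 = outer_deg4_opposite[OF sq d(2) my(1) y1] note o2 = outer_deg4_opposite[OF sq d(2) my(2) y2]
  have ww: "w \<noteq> w'" using outer_deg4_distinct[OF sqy my, of w w'] y1 y2 o1 by auto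
  have Ny': "N y = {z, x, y1, y2}" "distinct [z, x, y1, y2]" using Ny by auto
  have wx: "w \<in> N x'" "w' \<in> N x'" using outer_common[OF sq Nx Ny y1 y2] o1(4) o2(4) d(4) by auto
  have wz: "w \<in> N z'" "w' \<in> N z'" using outer_common[OF sqzr Nz Ny' y1 y2] o1(4) o2(4) d(4) by auto
  have xz_ne: "w \<noteq> x" "w \<noteq> z" "w' \<noteq> x" "w' \<noteq> z" using o1(2) o2(2) s(3,4) by auto
  have "free_edge x x'" using free_edge_square[OF sq, of x'] Nx by auto
  from free_edge_deg[OF this] d(1) have "dg x' \<le> 3" by auto
  moreover have "x \<in> N x'" using Nx N_sym[of x x'] by auto
  ultimately have Nx': "N x' = {x, w, w'}" using nbrs_eq3[of x' x w w'] wx ww xz_ne by auto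
  have "free_edge z z'" using free_edge_square[OF sqz, of z'] Nz by auto
  from free_edge_deg[OF this] d(3) have "dg z' \<le> 3" by auto
  moreover have "z \<in> N z'" using Nz N_sym[of z z'] by auto
  ultimately have Nz': "N z' = {z, w, w'}" using nbrs_eq3[of z' z w w'] wz ww xz_ne by auto
  obtain t1 t2 where Nt: "N t = {x, z, t1, t2}" "distinct [x, z, t1, t2]"
    and t1: "N t1 = {t, w}" and t2: "N t2 = {t, w'}"
  proof -
    obtain u u' where Nt: "N t = {x, z, u, u'}" "distinct [x, z, u, u']"
      using card_4_obtain_pair[OF d(4) s(8,7,9)] by metis
    have mt: "u \<in> N t - {z, x}" "u' \<in> N t - {z, x}" "u \<in> N t - {x, z}" "u' \<in> N t - {x, z}" "u \<noteq> u'" using Nt by auto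
    obtain v where u: "N u = {t, v}" using outer_deg4[OF sqt d(4) mt(3)] by metis
    obtain v' where u': "N u' = {t, v'}" using outer_deg4[OF sqt d(4) mt(4)] by metis
    note p1 = outer_deg4_opposite[OF sqxr d(4) mt(1) u] note p2 = outer_deg4_opposite[OF sqxr d(4) mt(2) u']
    have vv: "v \<noteq> v'" using outer_deg4_distinct[OF sqt mt(3-5), of v v'] u u' p1 by auto
    have Nxr: "N x = {t, y, x'}" "distinct [t, y, x']" using Nx by auto
    have "v \<in> N x'" "v' \<in> N x'" using outer_common[OF sqxr Nxr Nt u u'] p1(4) p2(4) d(2) by auto
    moreover have "v \<noteq> x" "v' \<noteq> x" using p1(2) p2(2) s(8) by auto
    \<comment> \<open>Besides \<open>x\<close>, only \<open>w\<close> and \<open>w'\<close> are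
      adjacent to \<open>x'\<close>, so the far ends seen from \<open>t\<close> are those seen from
      \<open>y\<close>.\<close>
    ultimately consider "v = w" "v' = w'" | "v = w'" "v' = w" using Nx' vv by auto
    then show ?thesis
    proof cases
      case 1
      then show ?thesis using that Nt u u' by simp
    next
      case 2
      have "N t = {x, z, u', u}" "distinct [x, z, u', u]" using Nt by auto
      from that[OF this] show ?thesis using 2 u u' by simp
    qed
  qed
  have mt: "t1 \<in> N t - {z, x}" "t2 \<in> N t - {z, x}" using Nt by auto
  have tdeg: "dg t1 = 2" "dg t2 = 2"
    using outer_deg4_opposite(3)[OF sqxr d(4) mt(1) t1] outer_deg4_opposite(3)[OF sqxr d(4) mt(2) t2] by auto
  have wt: "w \<notin> N t" "w' \<notin> N t" using o1(4) o2(4) d(4) by auto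
  have wyt: "w \<noteq> y" "w' \<noteq> y" "w \<noteq> t" "w' \<noteq> t"
    using o1(1) o2(1) tdeg t1 t2 by auto
  have yt: "y \<noteq> t" "x \<noteq> z" "y \<noteq> z" "x \<noteq> y" "x \<noteq> t" "z \<noteq> t" using s(11) by auto
  have xz': "x' \<noteq> z'" "x' \<noteq> x" "z' \<noteq> z" "x' \<noteq> z" "z' \<noteq> x"
  proof -
    have "x \<notin> N z'" unfolding Nz' using yt xz_ne by auto
    then show "x' \<noteq> z'" unfolding Nx' using \<open>x \<in> N x'\<close> by auto
    show "x' \<noteq> x" "z' \<noteq> z" using \<open>x \<in> N x'\<close> \<open>z \<in> N z'\<close> N_irrefl by auto
    have "z \<notin> N x" using triangle_free[OF s(1,4)] .
    then show "x' \<noteq> z" "z' \<noteq> x" using Nx Nz N_sym[of x z] by auto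
  qed
  have "distinct (map N [y1, y2, t1, t2])"
    using yt wyt ww by (simp add: y1 y2 t1 t2 doubleton_eq_iff)
  then have dm: "distinct [y1, y2, t1, t2]" by (rule distinct_map[THEN iffD1, THEN conjunct1])
  have deg2: "dg u = 2" if "u \<in> {y1, y2, t1, t2}" for u using that o1(3) o2(3) tdeg by auto
  have deg3: "dg u = 3" if "u \<in> {x, z, x', z'}" for u
  proof -
    have "dg x' = 3" unfolding Nx' using ww xz_ne by simp
    moreover have "dg z' = 3" unfolding Nz' using ww xz_ne by simp
    ultimately show ?thesis using that d(1,3) by auto
  qed
  have disj: "{y1, y2, t1, t2} \<inter> {x, z, x', z'} = {}"
    by (rule disjoint_by_degree[OF deg2 deg3]) simp_all
  have hub: "N h = {a, b, c, e}" if "a \<in> N h" "b \<in> N h" "c \<in> N h" "e \<in> N h" "distinct [a, b, c, e]" "dg c = 2" for a b c e h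
  proof -
    have "free_edge c h" using deg2_free_edge that(3,6) N_sym by blast
    from free_edge_deg[OF this] have "dg h \<le> 4" by auto
    then show ?thesis using that by (intro nbrs_eq4) auto
  qed
  have inw: "z' \<in> N w" "x' \<in> N w" "y1 \<in> N w" "t1 \<in> N w" "z' \<in> N w'" "x' \<in> N w'" "y2 \<in> N w'" "t2 \<in> N w'"
    using wx wz y1 y2 t1 t2 N_sym[of _ w] N_sym[of _ w'] by auto
  have Nw: "N w = {z', x', y1, t1}"
    by (rule hub) (use inw disj dm xz' o1(3) in auto)
  have Nw': "N w' = {z', x', y2, t2}"
    by (rule hub) (use inw disj dm xz' o2(3) in auto)
  have deg4: "dg u = 4" if "u \<in> {y, t, w, w'}" for u
  proof -
    have "dg w = 4" unfolding Nw using disj dm xz' by auto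
    moreover have "dg w' = 4" unfolding Nw' using disj dm xz' by auto
    ultimately show ?thesis using that d(2,4) by auto
  qed
  have disj': "{y1, y2, t1, t2} \<inter> {y, t, w, w'} = {}"
    by (rule disjoint_by_degree[OF deg2 deg4]) simp_all
  have disj'': "{x, z, x', z'} \<inter> {y, t, w, w'} = {}"
    by (rule disjoint_by_degree[OF deg3 deg4]) simp_all
  have "distinct [x, z, x', z']" using xz' yt by auto
  moreover have "distinct [y, t, w, w']" using yt wyt ww by auto
  ultimately have "distinct [y, x, t, z, z', w', w, x', y1, y2, t1, t2]" using dm disj disj' disj'' by auto
  moreover have "N x' = {x, w', w}" "N z' = {z, w', w}" using Nx' Nz' by auto
  ultimately show ?thesis
    using R2_iso Nx(1) Ny(1) Nz(1) Nt(1) Nw Nw' y1 y2 t1 t2 by blast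
qed

text \<open>Otherwise \<open>w\<close> is the outer neighbour of \<open>t\<close>. Degree 2 of
  \<open>w\<close> contradicts \<open>free_edge_2_2\<close> on \<open>v w\<close>. For degree 3 its
  third neighbour \<open>r\<close> would have to share a neighbour with \<open>x\<close> or
  \<open>z\<close>, but \<open>y\<close>, \<open>t\<close>, \<open>x'\<close>, \<open>z'\<close> are
  all excluded.\<close>

lemma square_3433_outer:
  assumes sq: "square E x y z t" and d: "dg x = 3" "dg y = 4" "dg z = 3" "dg t = 3"
    and Nx: "N x = {y, t, x'}" "distinct [y, t, x']" and Nz: "N z = {y, t, z'}" "distinct [y, t, z']"
    and Nt: "N t = {x, z, t'}" "distinct [x, z, t']"
    and v: "v \<in> N y - {z, x}" and Nv: "N v = {y, w}"
  shows "w \<notin> N t"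
proof
  note s = square_edges[OF sq]
  note sqt = square_rot[OF square_rot[OF square_rot[OF sq]]]
  note ov = outer_deg4_opposite[OF sq d(2) v Nv]
  assume "w \<in> N t"
  moreover have "w \<noteq> x" "w \<noteq> z" using ov(2) s(3,4) by auto
  ultimately have wt: "w = t'" using Nt by auto
  have vw: "v \<in> N w" "w \<in> N v" using Nv N_sym[of v w] by auto
  have tw: "t \<in> N w" using Nt N_sym[of t w] wt by auto
  have "t \<notin> N y" using triangle_free[OF s(3), of t] s(2) by auto
  then have vt: "v \<noteq> t" using v by auto
  have yt: "common_nbr E y t" using s(3,8) by (auto simp: common_nbr_iff)
  have o: "free_edge t w" using free_edge_square[OF sqt, of w] Nt wt by auto
  from free_edge_deg[OF this] d(4) consider "dg w = 2" | "dg w = 3" by auto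
  then show False
  proof cases
    case 1
    obtain t'' where "N w = {v, t''}" "t'' \<noteq> v" using card_2_obtain[OF 1 vw(1)] .
    with tw vt have Nw: "N w = {v, t}" by auto
    have Nv': "N v = {w, y}" using Nv by auto
    show False
      using free_edge_2_2[OF deg2_free_edge[OF ov(3) vw(2)] Nv' Nw] ov(1) vt yt by auto
  next
    case 2
    obtain r where Nw: "N w = {t, v, r}" "distinct [t, v, r]" using card_3_obtain_pair[OF 2 tw vw(1)] vt by metis
    then have Nw': "N w = {t, r, v}" "distinct [t, r, v]" by auto
    have Nt': "N t = {w, x, z}" "distinct [w, x, z]" using Nt wt by auto
    have rw: "r \<in> N w" "w \<in> N r" using Nw N_sym[of r w] by auto
    have rt: "r \<notin> N t" using triangle_free[of w t r] rw Nt wt by auto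
    \<comment> \<open>Otherwise \<open>v\<close>, of degree 2, would be a corner of the 4-cycle
      \<open>v\<close>, \<open>w\<close>, \<open>r\<close>, \<open>y\<close>.\<close>
    have ry: "r \<notin> N y"
    proof
      assume "r \<in> N y"
      then have "square E v w r y"
        using Nv vw rw Nw N_sym[of y r] N_sym[of v y] ov(1) v by (auto simp: square_def)
      with square_deg_ne2 ov(3) show False by blast
    qed
    have "N x = {t, y, x'}" "distinct [t, y, x']" "N z = {t, y, z'}" "distinct [t, y, z']"
      using Nx Nz by auto
    note Nxz = this
    have "N t = {x, z, w}" "distinct [x, z, w]" "N t = {z, x, w}" "distinct [z, x, w]"
      using Nt wt by auto
    note Ntw = this
    have "square E x t z y" "square E z t x y"
      using square_reflect[OF sq] square_rot[OF square_rot[OF sq]] by auto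
    then have "\<not> common_nbr E x' w" "\<not> common_nbr E z' w"
      using square_3_3 Nxz Ntw by blast+
    then have "r \<notin> N x'" "r \<notin> N z'" using rw(2) by (auto simp: common_nbr_iff N_sym[of w r])
    then have "\<not> common_nbr E r x" "\<not> common_nbr E r z"
      using Nx Nz rt ry N_sym[of _ r] by (auto simp: common_nbr_def)
    with free_edge_3_3[OF free_edge_sym[OF o] Nw'(1) Nt'(1) Nw'(2) Nt'(2)] show False by simp
  qed
qed

lemma square_3433:
  assumes sq: "square E x y z t" and d: "dg x = 3" "dg y = 4" "dg z = 3" "dg t = 3"
  shows "graph_iso V E R2_verts R2_edges"
proof -
  note s = square_edges[OF sq]
  note sqy = square_rot[OF sq] note sqz = square_rot[OF sqy]
  note sqzr = square_reflect[OF sqz]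
  obtain x' where Nx: "N x = {y, t, x'}" "distinct [y, t, x']" using card_3_obtain_pair[OF d(1) s(1,2,10)] .
  obtain z' where Nz: "N z = {y, t, z'}" "distinct [y, t, z']" using card_3_obtain_pair[OF d(3) s(5,6,10)] .
  obtain t' where Nt: "N t = {x, z, t'}" "distinct [x, z, t']" using card_3_obtain_pair[OF d(4) s(8,7,9)] .
  obtain y1 y2 where Ny: "N y = {x, z, y1, y2}" "distinct [x, z, y1, y2]"
    using card_4_obtain_pair[OF d(2) s(3,4,9)] by metis
  have my: "y1 \<in> N y - {z, x}" "y2 \<in> N y - {z, x}" "y1 \<noteq> y2" using Ny by auto
  obtain w where y1: "N y1 = {y, w}" using outer_deg4[OF sqy d(2) my(1)] by metis
  obtain w' where y2: "N y2 = {y, w'}" using outer_deg4[OF sqy d(2) my(2)] by metis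
  note o1 = outer_deg4_opposite[OF sq d(2) my(1) y1] note o2 = outer_deg4_opposite[OF sq d(2) my(2) y2]
  have wt: "w \<notin> N t" "w' \<notin> N t"
    using square_3433_outer[OF sq d Nx Nz Nt my(1) y1] square_3433_outer[OF sq d Nx Nz Nt my(2) y2] by auto
  have ww: "w \<noteq> w'" using outer_deg4_distinct[OF sqy my, of w w'] y1 y2 o1 by auto
  have Ny': "N y = {z, x, y1, y2}" "distinct [z, x, y1, y2]" using Ny by auto
  have wx: "w \<in> N x'" "w' \<in> N x'" using outer_common[OF sq Nx Ny y1 y2 wt] by auto
  have wz: "w \<in> N z'" "w' \<in> N z'" using outer_common[OF sqzr Nz Ny' y1 y2 wt] by auto
  have xz_ne: "w \<noteq> x" "w \<noteq> z" "w' \<noteq> x" "w' \<noteq> z" using o1(2) o2(2) s(3,4) by auto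
  have "free_edge x x'" using free_edge_square[OF sq, of x'] Nx by auto
  from free_edge_deg[OF this] d(1) have "dg x' \<le> 3" by auto
  moreover have x: "x \<in> N x'" using Nx N_sym[of x x'] by auto
  ultimately have Nx': "N x' = {w, w', x}" "N x' = {w', w, x}" using nbrs_eq3[of x' w w' x] wx ww xz_ne by auto
  have "free_edge z z'" using free_edge_square[OF sqz, of z'] Nz by auto
  from free_edge_deg[OF this] d(3) have "dg z' \<le> 3" by auto
  moreover have "z \<in> N z'" using Nz N_sym[of z z'] by auto
  ultimately have Nz': "N z' = {w, w', z}" using nbrs_eq3[of z' w w' z] wz ww xz_ne by auto
  have "x \<notin> N z'" unfolding Nz' using s(9) xz_ne by auto
  then have xz': "x' \<noteq> z'" using x by auto
  have sq': "square E x' w z' w'"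
    using wx wz ww xz' N_sym[of z' w] N_sym[of x' w'] by (simp add: square_def)
  \<comment> \<open>With \<open>u\<close> of degree 3, \<open>square_3_3\<close> on the edge
    \<open>x' u\<close> would forbid a common neighbour of \<open>x\<close> and \<open>yi\<close>,
    yet \<open>y\<close> is one. The second cycle thus has the pattern 3, 4, 3, 4.\<close>
  have deg4: "dg u = 4" if sqx: "square E x' u z' u'" and Nx': "N x' = {u, u', x}"
    and yi: "yi \<in> N y" "N yi = {y, u}" "dg yi = 2" and ne: "u \<noteq> u'" "u \<noteq> x" "u' \<noteq> x" "x' \<noteq> y" for u u' yi
  proof (rule ccontr)
    assume "dg u \<noteq> 4"
    then have u3: "dg u = 3"
      using square_deg[OF square_rot[OF sqx]] square_deg_ne2[OF square_rot[OF sqx]] by auto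
    note t = square_edges[OF sqx]
    have "yi \<in> N u" using yi(2) N_sym[of yi u] by auto
    have "yi \<noteq> x'" using yi(3) square_deg_ne2[OF sqx] by auto
    moreover have "yi \<noteq> z'" using yi(3) square_deg_ne2[OF square_rot[OF square_rot[OF sqx]]] by auto
    ultimately have Nu: "N u = {x', z', yi}" "distinct [x', z', yi]"
      using nbrs_eq3[of u x' z' yi] u3 t(3,4,9) \<open>yi \<in> N u\<close> by auto
    have "distinct [u, u', x]" using ne by auto
    with square_3_3[OF sqx Nx' Nu(1) _ Nu(2)] have "\<not> common_nbr E x yi" by simp
    moreover have "common_nbr E x yi" using s(1) yi(2) by (auto simp: common_nbr_iff)
    ultimately show False by simp
  qed
  have "x' \<noteq> y" using Nx by auto
  then have "dg w = 4" "dg w' = 4"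
    using deg4[OF sq' Nx'(1) _ y1 o1(3)] deg4[OF square_reflect[OF sq'] Nx'(2) _ y2 o2(3)] my ww xz_ne by auto
  moreover have "dg x' = 3" unfolding Nx'(1) using ww xz_ne by simp
  moreover have "dg z' = 3" unfolding Nz' using ww xz_ne by simp
  ultimately show ?thesis using square_3434[OF sq'] by simp
qed

lemma square_with_deg4:
  assumes sq: "square E x y z t" and y4: "dg y = 4"
  shows "graph_iso V E R1_verts R1_edges \<or> graph_iso V E R2_verts R2_edges"
proof -
  have deg: "dg a = 3 \<or> dg a = 4" if "square E a b c e" for a b c e
    using square_deg[OF that] square_deg_ne2[OF that] by auto
  note sqy = square_rot[OF sq] note sqz = square_rot[OF sqy] note sqt = square_rot[OF sqz]
  note sqx' = square_reflect[OF sq] note sqy' = square_reflect[OF sqy]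
  note sqz' = square_reflect[OF sqz] note sqt' = square_reflect[OF sqt]
  have d: "dg x = 3 \<or> dg x = 4" "dg z = 3 \<or> dg z = 4" "dg t = 3 \<or> dg t = 4"
    using deg[OF sq] deg[OF sqz] deg[OF sqt] by auto
  \<comment> \<open>\<open>no_4_4_3\<close> treats the corner next to \<open>a\<close>; on the
    flipped square it treats the corner next to \<open>b\<close>.\<close>
  have spread: "dg c = 4 \<and> dg e = 4" if "square E a b c e" "dg a = 4" "dg b = 4" for a b c e
    using that no_4_4_3[of a b c e] no_4_4_3[of b a e c] square_flip[OF that(1)]
      deg[OF square_rot[OF square_rot[OF that(1)]]] deg[OF square_rot[OF square_rot[OF square_rot[OF that(1)]]]]
    by auto
  show ?thesis
  proof (cases "dg x = 4 \<or> dg z = 4")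
    case True
    then have "dg x = 4" "dg z = 4" "dg t = 4"
      using spread[OF sq] spread[OF sqy] y4 by auto
    then show ?thesis using square_all_deg4[OF sq] y4 by simp
  next
    case False
    then show ?thesis using d square_3434[OF sq] square_3433[OF sq] y4 by auto
  qed
qed

lemma classification: "graph_iso V E R1_verts R1_edges \<or> graph_iso V E R2_verts R2_edges"
proof -
  obtain x y z t where sq: "square E x y z t" using square_exists .
  note sqy = square_rot[OF sq] note sqz = square_rot[OF sqy] note sqt = square_rot[OF sqz]
  have deg: "dg a = 3 \<or> dg a = 4" if "square E a b c e" for a b c e
    using square_deg[OF that] square_deg_ne2[OF that] by auto
  have "dg x = 4 \<or> dg y = 4 \<or> dg z = 4 \<or> dg t = 4"
    using not_all_deg3[OF sq] deg[OF sq] deg[OF sqy] deg[OF sqz] deg[OF sqt] by auto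
  then show ?thesis
    using square_with_deg4[OF sq] square_with_deg4[OF sqy] square_with_deg4[OF sqz] square_with_deg4[OF sqt]
    by auto
qed

end

theorem theorem2:
  fixes V :: "'a set" and E :: "'a set set"
  assumes "simple_graph V E"
    and "connected_graph V E"
    and "locally_finite_graph V E"
    and "girth E = 4"
    and "ricci_flat V E"
    and "no_vertex_on_two_4cycles V E"
  shows "graph_iso V E R1_verts R1_edges \<or> graph_iso V E R2_verts R2_edges"
proof -
  interpret flat_graph V E by unfold_locales (fact assms)+
  show ?thesis by (rule classification)
qed

end
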